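(* For every positive integer $m$, every $w\in\widetilde S_n$ and every $w'\in S_n$, $$D_{{\bf p}_m}(A_wA_{w'})=D_{{\bf p}_m}(A_w)A_{w'}.$$
   Context: Fix $n\ge2$. $\widetilde S_n$ is the affine symmetric group (bijections $w$ of $\mathbb Z$ with $w(i+n)=w(i)+n$, $\sum_{i=1}^nw(i)=\sum_{i=1}^ni$), Coxeter generators $s_0,\dots,s_{n-1}$, length $\ell$; $S_n\subset\widetilde S_n$ is the subgroup generated by $s_1,\dots,s_{n-1}$. For $i<j$, $i\not\equiv j\pmod n$, $t_{ij}$ swaps $i+rn$ and $j+rn$ for all $r$. $\mathbb A$ is the affine nilCoxeter algebra over $\mathbb Q$ with basis $A_w$ (generated by $A_0,\dots,A_{n-1}$, $A_i^2=0$, braid relations, $A_w$ the product along a reduced word; $A_uA_v=A_{uv}$ if $\ell(uv)=\ell(u)+\ell(v)$ and $0$ otherwise). Symbols $[ij]$ ($i<j$, $i\not\equiv j$) act on the right on $\mathbb A$ by $A_w\cdot[ij]=A_{wt_{ij}}$ if $\ell(wt_{ij})=\ell(w)-1$, else $0$, extended multiplicatively to words and linearly to (formal) sums; $D_{\bf x}(A_w):=A_w\cdot{\bf x}$. MN element ${\bf p}_m={\bf p}_m(0)$: for $a\in\mathbb Z$, a connected tree on $\mathcal D_a$ is a finite set $D$ of boxes $(i,j)$ with $i\le a<j$ such that the graph on $\mathbb Z$ with an edge $\{i,j\}$ per box has its non-isolated vertices forming a single tree with pairwise distinct residues mod $n$; $c(D)$ is the number of tree vertices $\le a$. For a bijection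 $L:\{1,\dots,|D|\}\to D$, $L(t)=(i_t,j_t)$, put $x_{D_L}=[i_1j_1]\cdots[i_{|D|}j_{|D|}]$; labelings are equivalent if their words differ by swaps of adjacent letters with disjoint supports. With $l$ the number of distinct second coordinates in $D$ and $v=|D|-l$, $M(D)$ is a set of one representative from each equivalence class containing a labeling with $i_1,\dots,i_{l-1}$ distinct, $j_1\le\dots\le j_{l-1}$, $j_l,\dots,j_{l+v}$ distinct, $i_l\le\dots\le i_{l+v}$. ${\bf p}_m(a)=\sum_D\sum_{L\in M(D)}(-1)^{c(D)-1}x_{D_L}$ over connected trees on $\mathcal D_a$ with $m$ boxes. *)

theory Defs
  imports Complex_Main "HOL-Library.Poly_Mapping" "HOL-Algebra.Generated_Groups"
begin

section \<open>The affine symmetric group\<close>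

definition affine_sym :: "nat \<Rightarrow> (int \<Rightarrow> int) set" where
  "affine_sym n = {w. bij w \<and> (\<forall>i. w (i + int n) = w i + int n) \<and>
     (\<Sum>i = 1..int n. w i) = (\<Sum>i = 1..int n. i)}"

definition affine_sym_group :: "nat \<Rightarrow> (int \<Rightarrow> int) monoid" where
  "affine_sym_group n = \<lparr>carrier = affine_sym n, mult = (\<circ>), one = id\<rparr>"

text \<open>Meaningful only if \<open>i\<close> and \<open>j\<close> are incongruent modulo \<open>n\<close>.\<close>
definition affine_transp :: "nat \<Rightarrow> int \<Rightarrow> int \<Rightarrow> int \<Rightarrow> int" where
  "affine_transp n i j x =
     (if int n dvd x - i then x + (j - i) else if int n dvd x - j then x - (j - i) else x)"

definition simple_refl :: "nat \<Rightarrow> nat \<Rightarrow> int \<Rightarrow> int" where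
  "simple_refl n i = affine_transp n (int i) (int i + 1)"

definition word_prod :: "nat \<Rightarrow> nat list \<Rightarrow> int \<Rightarrow> int" where
  "word_prod n is = foldr (\<lambda>i u. simple_refl n i \<circ> u) is id"

definition cox_length :: "nat \<Rightarrow> (int \<Rightarrow> int) \<Rightarrow> nat" where
  "cox_length n w = (LEAST k. \<exists>is. length is = k \<and> set is \<subseteq> {0..<n} \<and> word_prod n is = w)"

definition finite_sym :: "nat \<Rightarrow> (int \<Rightarrow> int) set" where
  "finite_sym n = generate (affine_sym_group n) (simple_refl n ` {1..<n})"


section \<open>The affine nilCoxeter algebra\<close>

text \<open>The algebra is the free rational vector space on the basis \<open>A w\<close>, \<open>w \<in> affine_sym n\<close>, with
  the structure constants of that basis. The type also contains vectors supported outside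
  \<^term>\<open>affine_sym n\<close>; they play no role.\<close>

type_synonym nilcox = "(int \<Rightarrow> int) \<Rightarrow>\<^sub>0 rat"

definition A :: "(int \<Rightarrow> int) \<Rightarrow> nilcox" where
  "A w = Poly_Mapping.single w 1"

definition scale :: "rat \<Rightarrow> nilcox \<Rightarrow> nilcox" where
  "scale c f = Poly_Mapping.map ((*) c) f"

definition lin_ext :: "((int \<Rightarrow> int) \<Rightarrow> nilcox) \<Rightarrow> nilcox \<Rightarrow> nilcox" where
  "lin_ext F f = (\<Sum>w\<in>Poly_Mapping.keys f. scale (Poly_Mapping.lookup f w) (F w))"

definition nil_mult :: "nat \<Rightarrow> nilcox \<Rightarrow> nilcox \<Rightarrow> nilcox" where
  "nil_mult n f g =
     lin_ext (\<lambda>u. lin_ext (\<lambda>v.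
       if cox_length n (u \<circ> v) = cox_length n u + cox_length n v then A (u \<circ> v) else 0) g) f"


section \<open>The right action of words and of formal sums of words\<close>

text \<open>The letter \<open>[ij]\<close> is the pair \<open>(i, j)\<close>.\<close>
type_synonym box = "int \<times> int"

definition act_letter :: "nat \<Rightarrow> nilcox \<Rightarrow> box \<Rightarrow> nilcox" where
  "act_letter n f b =
     lin_ext (\<lambda>w. let u = w \<circ> affine_transp n (fst b) (snd b) in
       if cox_length n u + 1 = cox_length n w then A u else 0) f"

definition act_word :: "nat \<Rightarrow> nilcox \<Rightarrow> box list \<Rightarrow> nilcox" where
  "act_word n f u = foldl (act_letter n) f u"

text \<open>A formal, possibly infinite, sum of words is its coefficient function. In \<open>D n x f\<close> only
  finitely many summands are nonzero when all letters \<open>(i, j)\<close> of the words in \<open>x\<close> satisfy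
  \<open>i \<le> a < j\<close> for a fixed \<open>a\<close> and the lengths of these words are bounded: there are finitely many
  elements of each length, and every reflection is \<open>t\<^sub>i\<^sub>j\<close> for finitely many such \<open>(i, j)\<close>.\<close>
definition D :: "nat \<Rightarrow> (box list \<Rightarrow> rat) \<Rightarrow> nilcox \<Rightarrow> nilcox" where
  "D n x f = Sum_any (\<lambda>u. scale (x u) (act_word n f u))"


section \<open>Connected trees\<close>

definition tree_verts :: "box set \<Rightarrow> int set" where
  "tree_verts T = fst ` T \<union> snd ` T"

definition adj :: "box set \<Rightarrow> int \<Rightarrow> int \<Rightarrow> bool" where
  "adj T x y \<longleftrightarrow> (x, y) \<in> T \<or> (y, x) \<in> T"

definition has_cycle :: "box set \<Rightarrow> bool" where
  "has_cycle T \<longleftrightarrow> (\<exists>vs. 3 \<le> length vs \<and> distinct vs \<and>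
     (\<forall>k < length vs. adj T (vs ! k) (vs ! (Suc k mod length vs))))"

definition connected_tree :: "nat \<Rightarrow> int \<Rightarrow> box set \<Rightarrow> bool" where
  "connected_tree n a T \<longleftrightarrow>
     finite T \<and> T \<noteq> {} \<and> (\<forall>(i, j)\<in>T. i \<le> a \<and> a < j) \<and>
     (\<forall>x\<in>tree_verts T. \<forall>y\<in>tree_verts T. (adj T)\<^sup>*\<^sup>* x y) \<and> \<not> has_cycle T \<and>
     inj_on (\<lambda>x. x mod int n) (tree_verts T)"

definition c_num :: "int \<Rightarrow> box set \<Rightarrow> nat" where
  "c_num a T = card {x \<in> tree_verts T. x \<le> a}"


section \<open>Labelings and Murnaghan--Nakayama elements\<close>

text \<open>A labeling \<open>L\<close> is the list \<open>[L(1), \<dots>, L(|T|)]\<close>, so it coincides with its word.\<close>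
definition labelings :: "box set \<Rightarrow> box list set" where
  "labelings T = {L. distinct L \<and> set L = T}"

definition swap_step :: "box list \<Rightarrow> box list \<Rightarrow> bool" where
  "swap_step L L' \<longleftrightarrow> (\<exists>us b b' vs. L = us @ b # b' # vs \<and> L' = us @ b' # b # vs \<and>
     {fst b, snd b} \<inter> {fst b', snd b'} = {})"

definition labeling_equiv :: "box set \<Rightarrow> (box list \<times> box list) set" where
  "labeling_equiv T = {(L, L'). L \<in> labelings T \<and> L' \<in> labelings T \<and> swap_step\<^sup>*\<^sup>* L L'}"

text \<open>Positions \<open>1, \<dots>, l - 1\<close> of \<open>L\<close> form \<open>take (l - 1) L\<close>, positions \<open>l, \<dots>, |T|\<close> form
  \<open>drop (l - 1) L\<close>.\<close>
definition MN_labeling :: "box set \<Rightarrow> box list \<Rightarrow> bool" where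
  "MN_labeling T L \<longleftrightarrow> L \<in> labelings T \<and>
     (let l = card (snd ` T); xs = take (l - 1) L; ys = drop (l - 1) L in
       distinct (map fst xs) \<and> sorted (map snd xs) \<and>
       distinct (map snd ys) \<and> sorted (map fst ys))"

definition MN_classes :: "box set \<Rightarrow> box list set set" where
  "MN_classes T = {C \<in> labelings T // labeling_equiv T. \<exists>L\<in>C. MN_labeling T L}"

definition MN_choice :: "nat \<Rightarrow> int \<Rightarrow> (box set \<Rightarrow> box list set) \<Rightarrow> bool" where
  "MN_choice n a M \<longleftrightarrow> (\<forall>T. connected_tree n a T \<longrightarrow>
     M T \<subseteq> \<Union> (MN_classes T) \<and> (\<forall>C\<in>MN_classes T. \<exists>!L. L \<in> M T \<inter> C))"

text \<open>A word \<open>u\<close> arises from at most one pair of a tree \<open>T\<close> and a labeling of it: \<open>T = set u\<close>,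
  labeled by \<open>u\<close> itself. This gives the coefficient of \<open>u\<close> in the sum over all such pairs.\<close>
definition MN_elem :: "nat \<Rightarrow> (box set \<Rightarrow> box list set) \<Rightarrow> nat \<Rightarrow> int \<Rightarrow> box list \<Rightarrow> rat" where
  "MN_elem n M m a u =
     (if connected_tree n a (set u) \<and> card (set u) = m \<and> u \<in> M (set u)
      then (- 1) ^ (c_num a (set u) - 1) else 0)"


section \<open>Well-definedness\<close>

lemma periodic_shift:
  fixes v :: "int \<Rightarrow> int"
  assumes "\<And>i. v (i + int n) = v i + int n"
  shows "v (i + k * int n) = v i + k * int n"
proof (induction k rule: int_induct[where k = 0])
  case base
  show ?case by simp
next
  case (step1 k)
  then show ?case using assms[of "i + k * int n"] by (simp add: algebra_simps)
next
  case (step2 k)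
  then show ?case using assms[of "i + (k - 1) * int n"] by (simp add: algebra_simps)
qed

lemma sum_periodic_reindex:
  fixes v g :: "int \<Rightarrow> int"
  assumes n: "n > 0" and v: "inj v" "\<And>i. v (i + int n) = v i + int n"
    and g: "\<And>i. g (i + int n) = g i"
  shows "(\<Sum>i = 1..int n. g (v i)) = (\<Sum>i = 1..int n. g i)"
proof -
  define r where "r x = (x - 1) mod int n + 1" for x
  have gk: "g (x + k * int n) = g x" for x k
    using periodic_shift[of "\<lambda>x. g x + x" n x k] g by (simp add: algebra_simps)
  have gr: "g (r x) = g x" for x
  proof -
    have "r x + ((x - 1) div int n) * int n = x"
      unfolding r_def by (simp add: algebra_simps)
    then show ?thesis using gk by metis
  qed
  have inj: "inj_on (r \<circ> v) {1..int n}"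
  proof (rule inj_onI)
    fix x y assume x: "x \<in> {1..int n}" and y: "y \<in> {1..int n}" and "(r \<circ> v) x = (r \<circ> v) y"
    then have "(v x - 1) mod int n = (v y - 1) mod int n" by (simp add: r_def)
    then have "int n dvd v x - v y" by (simp add: mod_eq_dvd_iff)
    then obtain k where "v x - v y = int n * k" by (auto elim: dvdE)
    then have "v x = v (y + k * int n)"
      using periodic_shift[of v n y k] v(2) by (simp add: algebra_simps)
    then have xy: "x = y + k * int n" using v(1) by (simp add: inj_eq)
    then have "(x - 1) mod int n = (y - 1) mod int n" by (simp add: mod_eq_dvd_iff)
    then show "x = y" using x y by simp
  qed
  have "(r \<circ> v) ` {1..int n} \<subseteq> {1..int n}"
    using n unfolding r_def by (auto simp: zless_imp_add1_zle add_increasing)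
  then have "(r \<circ> v) ` {1..int n} = {1..int n}"
    by (rule endo_inj_surj[OF _ _ inj, rotated]) simp
  then have "(\<Sum>i = 1..int n. g i) = (\<Sum>i = 1..int n. g ((r \<circ> v) i))"
    using sum.reindex[OF inj, of g] by simp
  then show ?thesis using gr by simp
qed

lemma group_affine_sym_group:
  assumes n: "n > 0"
  shows "group (affine_sym_group n)"
proof -
  have comp: "u \<circ> v \<in> affine_sym n" if u: "u \<in> affine_sym n" and v: "v \<in> affine_sym n" for u v
  proof -
    have "(\<Sum>i = 1..int n. u (v i) - v i) = (\<Sum>i = 1..int n. u i - i)"
      using u v n by (intro sum_periodic_reindex[of n v "\<lambda>i. u i - i"])
        (auto simp: affine_sym_def bij_def)
    then show ?thesis using u v by (auto simp: affine_sym_def bij_comp sum_subtractf)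
  qed
  have inv: "inv_into UNIV u \<in> affine_sym n" if u: "u \<in> affine_sym n" for u
  proof -
    have b: "bij u" and p: "\<And>i. u (i + int n) = u i + int n"
      using u by (auto simp: affine_sym_def)
    have ui: "u (inv_into UNIV u x) = x" "inv_into UNIV u (u x) = x" for x
      using b by (simp_all add: bij_def surj_f_inv_f)
    have pi: "inv_into UNIV u (i + int n) = inv_into UNIV u i + int n" for i
      by (metis p ui)
    have "(\<Sum>i = 1..int n. inv_into UNIV u (u i) - u i) = (\<Sum>i = 1..int n. inv_into UNIV u i - i)"
      using b p n pi by (intro sum_periodic_reindex[of n u "\<lambda>i. inv_into UNIV u i - i"])
        (auto simp: bij_def)
    then show ?thesis using u b pi by (auto simp: affine_sym_def bij_imp_bij_inv sum_subtractf ui)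
  qed
  show ?thesis
  proof (rule groupI)
    fix x assume "x \<in> carrier (affine_sym_group n)"
    then have x: "x \<in> affine_sym n" by (simp add: affine_sym_group_def)
    then have "inv_into UNIV x \<circ> x = id" by (simp add: affine_sym_def bij_def)
    with inv[OF x] show "\<exists>y\<in>carrier (affine_sym_group n).
        y \<otimes>\<^bsub>affine_sym_group n\<^esub> x = \<one>\<^bsub>affine_sym_group n\<^esub>"
      by (auto simp: affine_sym_group_def)
  next
    show "\<one>\<^bsub>affine_sym_group n\<^esub> \<in> carrier (affine_sym_group n)"
      by (simp add: affine_sym_group_def affine_sym_def)
  qed (auto simp: affine_sym_group_def comp o_assoc intro: comp)
qed

lemma equiv_labeling_equiv: "equiv (labelings T) (labeling_equiv T)"
proof (rule equivI)
  show "labeling_equiv T \<subseteq> labelings T \<times> labelings T"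
    by (auto simp: labeling_equiv_def)
  show "refl_on (labelings T) (labeling_equiv T)"
    by (auto simp: refl_on_def labeling_equiv_def)
  have "symp swap_step" by (rule sympI) (auto simp: swap_step_def, blast)
  then have "symp swap_step\<^sup>*\<^sup>*" by (rule symp_rtranclp)
  then show "sym (labeling_equiv T)"
    by (auto simp: sym_def labeling_equiv_def dest: sympD)
  show "trans (labeling_equiv T)"
    by (auto simp: trans_def labeling_equiv_def)
qed

lemma MN_choice_exists: "\<exists>M. MN_choice n a M"
proof -
  define M where "M T = (\<lambda>C. SOME L. L \<in> C) ` MN_classes T" for T
  have mem: "(SOME L. L \<in> C) \<in> C" if "C \<in> MN_classes T" for C T
    using that by (auto simp: MN_classes_def intro: someI)
  have disj: "C = C'" if "C \<in> MN_classes T" "C' \<in> MN_classes T" "L \<in> C" "L \<in> C'" for C C' T L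
    using quotient_disj[OF equiv_labeling_equiv, of C T C'] that by (auto simp: MN_classes_def)
  have "MN_choice n a M"
    unfolding MN_choice_def M_def by (auto 0 3 intro: mem dest: disj[OF _ _ _ mem] disj[OF _ _ mem])
  then show ?thesis by blast
qed

end

theory Submission
  imports Defs "HOL-Library.Multiset"
begin

text \<open>Let \<open>s\<close> be one of \<open>s\<^sub>1, \<dots>, s\<^sub>n\<^sub>-\<^sub>1\<close>. As \<open>s\<close> does not exchange \<open>0\<close> and \<open>1\<close>, comparing
  lengths gives \<open>(A\<^sub>w A\<^sub>s) \<cdot> [ij] = (A\<^sub>w \<cdot> [s(i) s(j)]) A\<^sub>s\<close> whenever \<open>i \<le> 0 < j\<close>. It therefore
  suffices that the element \<open>p\<^sub>m\<close> and its image under relabeling all vertices by \<open>s\<close> act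
  in the same way. Letters with disjoint supports commute as operators, so the action of a
  labeling depends only on its class; and the monotonicity conditions in the definition of
  \<open>M(D)\<close> can always be achieved by such commutations once the distinctness conditions hold.
  Thus whether \<open>M(D)\<close> represents a class does not depend on the order of the vertices, and
  relabeling permutes the summands. Induction on a reduced word of \<open>w'\<close> in
  \<open>s\<^sub>1, \<dots>, s\<^sub>n\<^sub>-\<^sub>1\<close> then gives the theorem.\<close>

section \<open>Length in the affine symmetric group\<close>

lemma affine_sym_periodic:
  assumes "w \<in> affine_sym n"
  shows "w (x + k * int n) = w x + k * int n"
  using assms by (intro periodic_shift) (simp add: affine_sym_def)

lemma affine_sym_inj: "w \<in> affine_sym n \<Longrightarrow> w x = w y \<longleftrightarrow> x = y"
  by (auto simp: affine_sym_def bij_def inj_eq)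

lemma affine_sym_comp:
  assumes "n > 0" "u \<in> affine_sym n" "v \<in> affine_sym n"
  shows "u \<circ> v \<in> affine_sym n"
  using monoid.m_closed[OF group.is_monoid[OF group_affine_sym_group[OF assms(1)]], of u v] assms(2,3)
  by (simp add: affine_sym_group_def)

lemma id_affine_sym: "id \<in> affine_sym n"
  by (simp add: affine_sym_def)

text \<open>Periodicity gives one direction. Conversely, two values that differ by a multiple of
  \<open>n\<close> agree once one argument is shifted by that multiple, and injectivity then relates
  the arguments.\<close>

lemma affine_sym_dvd_iff:
  assumes w: "w \<in> affine_sym n"
  shows "int n dvd w x - w y \<longleftrightarrow> int n dvd x - y"
proof
  assume "int n dvd w x - w y"
  then obtain k where "w x - w y = int n * k" by (auto elim: dvdE)
  then have "w x = w (y + k * int n)"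
    using affine_sym_periodic[OF w] by (simp add: algebra_simps)
  then show "int n dvd x - y" using affine_sym_inj[OF w] by simp
next
  assume "int n dvd x - y"
  then obtain k where "x - y = int n * k" by (auto elim: dvdE)
  then have "x = y + k * int n" by (simp add: algebra_simps)
  then show "int n dvd w x - w y" using affine_sym_periodic[OF w, of y k] by simp
qed

lemma affine_sym_mod_eq_iff:
  assumes "w \<in> affine_sym n"
  shows "w x mod int n = w y mod int n \<longleftrightarrow> x mod int n = y mod int n"
  using affine_sym_dvd_iff[OF assms] by (simp add: mod_eq_dvd_iff)

section \<open>Affine reflections and their conjugates\<close>

lemma affine_transp_left: "affine_transp n i j i = j"
  by (simp add: affine_transp_def)

lemma affine_transp_right: "\<not> int n dvd j - i \<Longrightarrow> affine_transp n i j j = i"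
  by (simp add: affine_transp_def)

lemma affine_transp_other:
  "\<not> int n dvd x - i \<Longrightarrow> \<not> int n dvd x - j \<Longrightarrow> affine_transp n i j x = x"
  by (simp add: affine_transp_def)

lemma affine_transp_involution:
  assumes "\<not> int n dvd j - i"
  shows "affine_transp n i j \<circ> affine_transp n i j = id"
proof (rule ext)
  fix x
  have 1: "int n dvd x + (j - i) - j \<longleftrightarrow> int n dvd x - i" by (simp add: algebra_simps)
  have 2: "int n dvd x - (j - i) - i \<longleftrightarrow> int n dvd x - j" by (simp add: algebra_simps)
  have 3: "\<not> int n dvd x + (j - i) - i" if "int n dvd x - i"
  proof
    assume "int n dvd x + (j - i) - i"
    from dvd_diff[OF this that] assms show False by simp
  qed
  show "(affine_transp n i j \<circ> affine_transp n i j) x = id x"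
    using 1 2 3 by (simp add: affine_transp_def)
qed

lemma affine_transp_affine_sym:
  assumes n: "n > 0" and ij: "\<not> int n dvd j - i"
  shows "affine_transp n i j \<in> affine_sym n"
proof -
  let ?t = "affine_transp n i j"
  let ?g = "\<lambda>k x. if int n dvd x - k then 1 else 0 :: int"
  have per: "int n dvd x + int n - k \<longleftrightarrow> int n dvd x - k" for x k
  proof -
    have "x + int n - k = (x - k) + int n" by simp
    then show ?thesis by (simp only: dvd_add_triv_right_iff)
  qed
  have "bij ?t"
    by (rule o_bij[OF affine_transp_involution[OF ij] affine_transp_involution[OF ij]])
  moreover have "?t (x + int n) = ?t x + int n" for x
    by (simp add: affine_transp_def per)
  moreover have "(\<Sum>x = 1..int n. ?t x) = (\<Sum>x = 1..int n. x)"
  proof -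
    have excl: "\<not> (int n dvd x - i \<and> int n dvd x - j)" for x
      using ij dvd_diff[of "int n" "x - i" "x - j"] by auto
    \<comment> \<open>The displacement is a multiple of a difference of two residue class
      indicators. Their sums over a period agree, as the shift by \<open>j - i\<close> carries one
      indicator to the other.\<close>
    have "?t x = x + (j - i) * (?g i x - ?g j x)" for x
      using excl[of x] by (auto simp: affine_transp_def)
    then have "(\<Sum>x = 1..int n. ?t x)
        = (\<Sum>x = 1..int n. x) + (j - i) * ((\<Sum>x = 1..int n. ?g i x) - (\<Sum>x = 1..int n. ?g j x))"
      by (simp add: sum.distrib sum_subtractf sum_distrib_left[symmetric])
    moreover have "(\<Sum>x = 1..int n. ?g j (x + (j - i))) = (\<Sum>x = 1..int n. ?g j x)"
      using n per by (intro sum_periodic_reindex) (auto simp: inj_def)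
    then have "(\<Sum>x = 1..int n. ?g i x) = (\<Sum>x = 1..int n. ?g j x)" by simp
    ultimately show ?thesis by simp
  qed
  ultimately show ?thesis by (simp add: affine_sym_def)
qed

text \<open>The usual rule for conjugating a transposition, written without an inverse. It extends
  to whole residue classes because \<open>q\<close> commutes with translation by multiples of
  \<open>n\<close>.\<close>

lemma affine_transp_conj:
  assumes q: "q \<in> affine_sym n"
  shows "q \<circ> affine_transp n i j = affine_transp n (q i) (q j) \<circ> q"
proof (rule ext)
  fix x
  have shift: "q (x + (k - l)) = q x + (q k - q l)" if "int n dvd x - l" for k l
  proof -
    from that obtain r where "x - l = int n * r" by (auto elim: dvdE)
    then have x: "x = l + r * int n" by (simp add: algebra_simps)
    then have "x + (k - l) = k + r * int n" by simp
    then show ?thesis using affine_sym_periodic[OF q, of k r] affine_sym_periodic[OF q, of l r] x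
      by (simp only:)
  qed
  show "(q \<circ> affine_transp n i j) x = (affine_transp n (q i) (q j) \<circ> q) x"
    using shift[of i j] shift[of j i] affine_sym_dvd_iff[OF q]
    by (simp add: affine_transp_def diff_diff_eq2 add_diff_eq)
qed

text \<open>One reflection has many names. With \<open>d = 1\<close> this recognises a simple
  reflection from the residue of its lower point.\<close>

lemma affine_transp_cong:
  assumes "int n dvd k - i"
  shows "affine_transp n k (k + d) = affine_transp n i (i + d)"
proof (rule ext)
  fix x
  have "int n dvd x - k \<longleftrightarrow> int n dvd x - i"
    using dvd_add_left_iff[OF assms, of "x - k"] by simp
  moreover have "int n dvd x - (k + d) \<longleftrightarrow> int n dvd x - (i + d)"
    using dvd_add_left_iff[OF assms, of "x - (k + d)"] by (simp add: algebra_simps)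
  ultimately show "affine_transp n k (k + d) x = affine_transp n i (i + d) x"
    by (simp add: affine_transp_def)
qed

section \<open>Simple reflections, words and exchange\<close>

lemma not_dvd_one: "n \<ge> 2 \<Longrightarrow> \<not> int n dvd 1"
  using zdvd_imp_le[of "int n" 1] by auto

lemma simple_refl_affine_sym: "n \<ge> 2 \<Longrightarrow> simple_refl n i \<in> affine_sym n"
  unfolding simple_refl_def by (rule affine_transp_affine_sym) (auto simp: not_dvd_one)

lemma simple_refl_involution: "n \<ge> 2 \<Longrightarrow> simple_refl n i \<circ> simple_refl n i = id"
  unfolding simple_refl_def by (rule affine_transp_involution) (simp add: not_dvd_one)

lemma word_prod_Nil [simp]: "word_prod n [] = id"
  by (simp add: word_prod_def)

lemma word_prod_Cons [simp]: "word_prod n (i # is) = simple_refl n i \<circ> word_prod n is"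
  by (simp add: word_prod_def)

lemma word_prod_append: "word_prod n (is @ js) = word_prod n is \<circ> word_prod n js"
  by (induction "is") (auto simp: o_assoc)

lemma word_prod_snoc: "word_prod n (is @ [i]) = word_prod n is \<circ> simple_refl n i"
  by (simp add: word_prod_append)

lemma word_prod_affine_sym: "n \<ge> 2 \<Longrightarrow> word_prod n is \<in> affine_sym n"
  by (induction "is") (auto simp: id_affine_sym intro!: affine_sym_comp simple_refl_affine_sym)

text \<open>Along the suffixes of the word, the images of \<open>a < b\<close> must change order at some letter; that
  letter is then the reflection in the two images and can be deleted.\<close>

lemma word_exchange:
  assumes n: "n \<ge> 2" and ab: "a < b" "\<not> int n dvd b - a"
    and "word_prod n is b < word_prod n is a"
  shows "\<exists>js. Suc (length js) = length is \<and> set js \<subseteq> set is \<and>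
    word_prod n js = word_prod n is \<circ> affine_transp n a b"
  using assms(4)
proof (induction "is")
  case Nil
  then show ?case using ab by simp
next
  case (Cons i "is")
  let ?q = "word_prod n is"
  have q: "?q \<in> affine_sym n" by (rule word_prod_affine_sym[OF n])
  show ?case
  proof (cases "?q b < ?q a")
    case True
    from Cons.IH[OF this] obtain js where
      js: "Suc (length js) = length is" "set js \<subseteq> set is"
        "word_prod n js = ?q \<circ> affine_transp n a b" by blast
    show ?thesis by (rule exI[of _ "i # js"]) (use js in \<open>auto simp: o_assoc\<close>)
  next
    case False
    then have lt: "?q a < ?q b" using ab(1) affine_sym_inj[OF q, of a b] by linarith
    have gt: "simple_refl n i (?q b) < simple_refl n i (?q a)" using Cons.prems by simp
    \<comment> \<open>A simple reflection moves points by at most one, so it can reverse only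
      neighbours, and then it must exchange them.\<close>
    have "int n dvd ?q a - int i \<and> ?q b = ?q a + 1"
      using lt gt not_dvd_one[OF n]
      by (auto simp: simple_refl_def affine_transp_def split: if_splits)
    then have "affine_transp n (?q a) (?q b) = simple_refl n i"
      unfolding simple_refl_def using affine_transp_cong[of n "?q a" "int i" 1] by simp
    then have "word_prod n (i # is) \<circ> affine_transp n a b = simple_refl n i \<circ> simple_refl n i \<circ> ?q"
      using affine_transp_conj[OF q, of a b] by (simp add: comp_assoc)
    then have "word_prod n is = word_prod n (i # is) \<circ> affine_transp n a b"
      using simple_refl_involution[OF n, of i] by (simp only: id_comp)
    moreover have "Suc (length is) = length (i # is)" "set is \<subseteq> set (i # is)" by auto
    ultimately show ?thesis by blast
  qed
qed

text \<open>The sum of squared displacements over a period is the termination measure for sorting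
  \<open>w\<close>. Removing a descent at \<open>i\<close> lowers it by
  \<open>2 * (w i - w (i + 1))\<close>.\<close>

lemma descent_sum_squares:
  assumes n: "n \<ge> 2" and w: "w \<in> affine_sym n" and desc: "w (int i + 1) < w (int i)"
  shows "(\<Sum>x = 1..int n. (w (simple_refl n i x) - x)\<^sup>2) < (\<Sum>x = 1..int n. (w x - x)\<^sup>2)"
proof -
  let ?s = "simple_refl n i"
  have s: "?s \<in> affine_sym n" by (rule simple_refl_affine_sym[OF n])
  have per: "v (x + int n) = v x + int n" if "v \<in> affine_sym n" for v x
    using affine_sym_periodic[OF that, of x 1] by simp
  \<comment> \<open>Reindexing by the reflection replaces the old sum by one that differs from the
    new sum only at points moved by the reflection, so \<open>g\<close> vanishes at all fixed
    points.\<close>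
  define g where "g x = (w (?s x) - x)\<^sup>2 - (w (?s x) - ?s x)\<^sup>2" for x
  have "(\<Sum>x = 1..int n. (w (?s x) - ?s x)\<^sup>2) = (\<Sum>x = 1..int n. (w x - x)\<^sup>2)"
  proof (rule sum_periodic_reindex)
    show "inj ?s" using s by (simp add: affine_sym_def bij_def)
  qed (use n in \<open>simp_all add: per[OF s] per[OF w]\<close>)
  then have "(\<Sum>x = 1..int n. (w (?s x) - x)\<^sup>2) - (\<Sum>x = 1..int n. (w x - x)\<^sup>2)
      = (\<Sum>x = 1..int n. g x)"
    by (simp add: g_def sum_subtractf)
  \<comment> \<open>The period is shifted so that \<open>i\<close> and \<open>i + 1\<close> become
    its first two points; otherwise the pair could straddle its end.\<close>
  also have "\<dots> = (\<Sum>x = 1..int n. g (x + (int i - 1)))"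
  proof (rule sum_periodic_reindex[symmetric])
    show "g (x + int n) = g x" for x by (simp add: g_def per[OF s] per[OF w])
  qed (use n in \<open>auto simp: inj_def\<close>)
  also have "\<dots> = (\<Sum>x \<in> {1, 2}. g (x + (int i - 1)))"
  proof (rule sum.mono_neutral_right)
    show "\<forall>x\<in>{1..int n} - {1, 2}. g (x + (int i - 1)) = 0"
    proof
      fix x assume "x \<in> {1..int n} - {1, 2}"
      then have "3 \<le> x" "x \<le> int n" by auto
      then have "\<not> int n dvd x - 1" "\<not> int n dvd x - 2"
        using zdvd_imp_le[of "int n" "x - 1"] zdvd_imp_le[of "int n" "x - 2"] by auto
      then have "?s (x + (int i - 1)) = x + (int i - 1)"
        unfolding simple_refl_def by (intro affine_transp_other) (simp_all add: algebra_simps)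
      then show "g (x + (int i - 1)) = 0" by (simp add: g_def)
    qed
  qed (use n in auto)
  also have "\<dots> = g (int i) + g (int i + 1)" by (simp add: algebra_simps)
  also have "\<dots> = 2 * (w (int i + 1) - w (int i))"
  proof -
    have "?s (int i) = int i + 1" "?s (int i + 1) = int i"
      using not_dvd_one[OF n] by (simp_all add: simple_refl_def affine_transp_def)
    then show ?thesis by (simp add: g_def power2_eq_square algebra_simps)
  qed
  finally show ?thesis using desc by simp
qed

text \<open>An increasing surjection of the integers has unit steps, hence is a translation; the
  normalisation of the sum over a period forces the translation to be trivial.\<close>

lemma affine_sym_increasing_eq_id:
  assumes n: "n > 0" and w: "w \<in> affine_sym n" and inc: "\<And>x. w x < w (x + 1)"
  shows "w = id"
proof -
  have mono: "strict_mono w"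
  proof -
    have "w x < w (x + 1 + int k)" for x k
    proof (induction k)
      case (Suc k)
      then show ?case using inc[of "x + 1 + int k"] by (simp add: algebra_simps)
    qed (use inc in simp)
    then have "w x < w y" if "x < y" for x y
      using that zless_iff_Suc_zadd[of x y] by (metis add.assoc add.commute of_nat_Suc)
    then show ?thesis by (simp add: strict_mono_def)
  qed
  have "surj w" using w by (simp add: affine_sym_def bij_def)
  have step: "w (x + 1) = w x + 1" for x
  proof -
    obtain y where y: "w y = w x + 1" using \<open>surj w\<close> by (metis surjD)
    then have "x < y" using strict_mono_less[OF mono, of x y] by simp
    then have "w (x + 1) \<le> w y" using strict_mono_less_eq[OF mono] by simp
    then show ?thesis using y inc[of x] by simp
  qed
  have shift: "w x = x + w 0" for x
  proof (induction x rule: int_induct[where k = 0])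
    case (step2 x)
    then show ?case using step[of "x - 1"] by simp
  qed (use step in auto)
  have "(\<Sum>x = 1..int n. w x) = (\<Sum>x = 1..int n. x + w 0)" by (rule sum.cong) (auto intro: shift)
  then have "(\<Sum>x = 1..int n. x + w 0) = (\<Sum>x = 1..int n. x)" using w by (simp add: affine_sym_def)
  then have "w 0 = 0" using n by (simp add: sum.distrib)
  then have "w x = id x" for x using shift[of x] by simp
  then show ?thesis by (rule ext)
qed

text \<open>Bubble sort: descents are removed by simple reflections until \<open>w\<close> is
  increasing, hence the identity. As every element has a word, the \<open>LEAST\<close> in
  \<open>cox_length\<close> is attained.\<close>

lemma affine_sym_word:
  assumes n: "n \<ge> 2" and "w \<in> affine_sym n"
  shows "\<exists>is. set is \<subseteq> {0..<n} \<and> word_prod n is = w"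
  using assms(2)
proof (induction "nat (\<Sum>x = 1..int n. (w x - x)\<^sup>2)" arbitrary: w rule: less_induct)
  case less
  note w = less.prems
  show ?case
  proof (cases "\<exists>i<n. w (int i + 1) < w (int i)")
    case True
    then obtain i where i: "i < n" "w (int i + 1) < w (int i)" by blast
    let ?s = "simple_refl n i"
    have ws: "w \<circ> ?s \<in> affine_sym n"
      using n w by (intro affine_sym_comp simple_refl_affine_sym) auto
    have lt: "(\<Sum>x = 1..int n. ((w \<circ> ?s) x - x)\<^sup>2) < (\<Sum>x = 1..int n. (w x - x)\<^sup>2)"
      using descent_sum_squares[OF n w i(2)] by simp
    have "nat (\<Sum>x = 1..int n. ((w \<circ> ?s) x - x)\<^sup>2) < nat (\<Sum>x = 1..int n. (w x - x)\<^sup>2)"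
      using lt by (intro nat_mono_iff[THEN iffD2]) (auto intro: le_less_trans[OF sum_nonneg lt])
    from less.hyps[OF this ws] obtain "is" where
      "is": "set is \<subseteq> {0..<n}" "word_prod n is = w \<circ> ?s" by blast
    have "word_prod n (is @ [i]) = w"
      using "is" simple_refl_involution[OF n, of i] by (simp add: word_prod_append comp_assoc)
    then show ?thesis using "is" i by (intro exI[of _ "is @ [i]"]) auto
  next
    case False
    \<comment> \<open>Ascents at \<open>0, ..., n - 1\<close> spread to all integers by
      periodicity.\<close>
    have inc: "w x < w (x + 1)" for x
    proof -
      let ?i = "nat (x mod int n)" and ?k = "x div int n"
      have x: "x = int ?i + ?k * int n" using n by simp
      have "?i < n" using n by (simp add: nat_less_iff)
      then have "\<not> w (int ?i + 1) < w (int ?i)" using False by blast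
      then have "w (int ?i) < w (int ?i + 1)"
        using affine_sym_inj[OF w, of "int ?i" "int ?i + 1"] by linarith
      moreover have "w x = w (int ?i) + ?k * int n"
        using affine_sym_periodic[OF w, of "int ?i" ?k] x by (simp only:)
      moreover have "w (x + 1) = w (int ?i + 1) + ?k * int n"
      proof -
        have "x + 1 = int ?i + 1 + ?k * int n" using x by linarith
        then show ?thesis using affine_sym_periodic[OF w, of "int ?i + 1" ?k] by (simp only:)
      qed
      ultimately show ?thesis by linarith
    qed
    have "n > 0" using n by simp
    from affine_sym_increasing_eq_id[OF this w] inc have "w = id" .
    then show ?thesis by (intro exI[of _ "[]"]) simp
  qed
qed

section \<open>Length and reflections\<close>

lemma cox_length_le:
  "set is \<subseteq> {0..<n} \<Longrightarrow> cox_length n (word_prod n is) \<le> length is"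
  unfolding cox_length_def by (rule Least_le) blast

lemma reduced_word_exists:
  assumes "n \<ge> 2" "w \<in> affine_sym n"
  obtains "is" where "set is \<subseteq> {0..<n}" "word_prod n is = w" "length is = cox_length n w"
proof -
  have "\<exists>k is. length is = k \<and> set is \<subseteq> {0..<n} \<and> word_prod n is = w"
    using affine_sym_word[OF assms] by blast
  from LeastI_ex[OF this] show ?thesis using that unfolding cox_length_def by blast
qed

lemma cox_length_comp_le:
  assumes "n \<ge> 2" "u \<in> affine_sym n" "v \<in> affine_sym n"
  shows "cox_length n (u \<circ> v) \<le> cox_length n u + cox_length n v"
proof -
  obtain "is" js where
    "set is \<subseteq> {0..<n}" "word_prod n is = u" "length is = cox_length n u"
    "set js \<subseteq> {0..<n}" "word_prod n js = v" "length js = cox_length n v"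
    using assms by (metis reduced_word_exists)
  then show ?thesis using cox_length_le[of "is @ js" n] by (simp add: word_prod_append)
qed

text \<open>Exchange deletes a letter from a reduced word of \<open>u\<close>.\<close>

lemma cox_length_transp_less_if:
  assumes n: "n \<ge> 2" and u: "u \<in> affine_sym n" and ab: "a < b" "\<not> int n dvd b - a"
    and "u b < u a"
  shows "cox_length n (u \<circ> affine_transp n a b) < cox_length n u"
proof -
  obtain "is" where "is": "set is \<subseteq> {0..<n}" "word_prod n is = u" "length is = cox_length n u"
    using reduced_word_exists[OF n u] .
  then obtain js where "Suc (length js) = length is" "set js \<subseteq> set is"
      "word_prod n js = u \<circ> affine_transp n a b"
    using word_exchange[OF n ab, of "is"] assms(5) by auto
  then have "cox_length n (u \<circ> affine_transp n a b) \<le> length js" "Suc (length js) = length is"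
    using cox_length_le[of js n] "is"(1) by force+
  then show ?thesis using "is"(3) by linarith
qed

text \<open>After the reflection the values at \<open>a\<close> and \<open>b\<close> are in the
  opposite order, so the previous lemma applies to the product and reflects back to
  \<open>u\<close>.\<close>

lemma cox_length_transp_greater_if:
  assumes n: "n \<ge> 2" and u: "u \<in> affine_sym n" and ab: "a < b" "\<not> int n dvd b - a"
    and "u a < u b"
  shows "cox_length n u < cox_length n (u \<circ> affine_transp n a b)"
proof -
  let ?t = "affine_transp n a b"
  have "u \<circ> ?t \<in> affine_sym n"
    using n u ab by (intro affine_sym_comp affine_transp_affine_sym) auto
  from cox_length_transp_less_if[OF n this ab] assms(5) show ?thesis
    using affine_transp_involution[OF ab(2)]
    by (simp add: affine_transp_left affine_transp_right[OF ab(2)] comp_assoc)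
qed

text \<open>Turns length comparisons into comparisons of two values of \<open>u\<close>, the form in
  which the commutation arguments below use them.\<close>

lemma cox_length_transp_less_iff:
  assumes n: "n \<ge> 2" and u: "u \<in> affine_sym n" and ab: "a < b" "\<not> int n dvd b - a"
  shows "cox_length n (u \<circ> affine_transp n a b) < cox_length n u \<longleftrightarrow> u b < u a"
proof -
  have "u a \<noteq> u b" using affine_sym_inj[OF u, of a b] ab(1) by simp
  then show ?thesis
    using cox_length_transp_less_if[OF assms] cox_length_transp_greater_if[OF assms] by linarith
qed

lemma cox_length_transp_neq:
  assumes n: "n \<ge> 2" and u: "u \<in> affine_sym n" and ab: "a < b" "\<not> int n dvd b - a"
  shows "cox_length n (u \<circ> affine_transp n a b) \<noteq> cox_length n u"
proof -
  have "u a \<noteq> u b" using affine_sym_inj[OF u, of a b] ab(1) by simp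
  then show ?thesis
    using cox_length_transp_less_if[OF assms] cox_length_transp_greater_if[OF assms] by linarith
qed

lemma cox_length_simple_refl_le: "i < n \<Longrightarrow> cox_length n (simple_refl n i) \<le> 1"
  using cox_length_le[of "[i]" n] by simp

text \<open>Subadditivity, applied to \<open>u\<close> and to its product with the reflection,
  bounds the change by one; a reflection never preserves the length.\<close>

lemma cox_length_comp_simple_refl:
  assumes n: "n \<ge> 2" and u: "u \<in> affine_sym n" and i: "i < n"
  shows "cox_length n (u \<circ> simple_refl n i) = Suc (cox_length n u) \<or>
         Suc (cox_length n (u \<circ> simple_refl n i)) = cox_length n u"
proof -
  let ?s = "simple_refl n i"
  have s: "?s \<in> affine_sym n" by (rule simple_refl_affine_sym[OF n])
  have us: "u \<circ> ?s \<in> affine_sym n" using n u s by (intro affine_sym_comp) auto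
  have "cox_length n (u \<circ> ?s) \<le> cox_length n u + 1"
    using cox_length_comp_le[OF n u s] cox_length_simple_refl_le[OF i] by simp
  moreover have "cox_length n (u \<circ> ?s \<circ> ?s) \<le> cox_length n (u \<circ> ?s) + 1"
    using cox_length_comp_le[OF n us s] cox_length_simple_refl_le[OF i] by simp
  then have "cox_length n u \<le> cox_length n (u \<circ> ?s) + 1"
    using simple_refl_involution[OF n, of i] by (simp add: comp_assoc)
  moreover have "cox_length n (u \<circ> ?s) \<noteq> cox_length n u"
    using cox_length_transp_neq[OF n u, of "int i" "int i + 1"] not_dvd_one[OF n]
    by (simp add: simple_refl_def)
  ultimately show ?thesis by linarith
qed

lemma cox_length_id: "cox_length n id = 0"
  using cox_length_le[of "[]" n] by simp

lemma cox_length_simple_refl: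
  assumes "n \<ge> 2" "i < n"
  shows "cox_length n (simple_refl n i) = 1"
  using cox_length_comp_simple_refl[OF assms(1) id_affine_sym assms(2)] by (simp add: cox_length_id)

section \<open>Reduced words in the finite symmetric group\<close>

lemma finite_sym_word:
  assumes n: "n \<ge> 2" and "w \<in> finite_sym n"
  shows "\<exists>is. set is \<subseteq> {1..<n} \<and> word_prod n is = w"
  using assms(2) unfolding finite_sym_def
proof (induction rule: generate.induct)
  case one
  show ?case by (intro exI[of _ "[]"]) (simp add: affine_sym_group_def)
next
  case (incl h)
  then obtain i where "i \<in> {1..<n}" "h = simple_refl n i" by auto
  then show ?case by (intro exI[of _ "[i]"]) simp
next
  case (inv h)
  then obtain i where i: "i \<in> {1..<n}" "h = simple_refl n i" by auto
  have "inv\<^bsub>affine_sym_group n\<^esub> h = h"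
    using group.inv_equality[OF group_affine_sym_group, of n h h] n i
      simple_refl_affine_sym[OF n, of i] simple_refl_involution[OF n, of i]
    by (simp add: affine_sym_group_def)
  then show ?case using i by (intro exI[of _ "[i]"]) simp
next
  case (eng h1 h2)
  then obtain is1 is2 where "set is1 \<subseteq> {1..<n}" "word_prod n is1 = h1"
    "set is2 \<subseteq> {1..<n}" "word_prod n is2 = h2" by blast
  then show ?case
    by (intro exI[of _ "is1 @ is2"]) (simp add: word_prod_append affine_sym_group_def)
qed

text \<open>By the exchange property, a word that is shortest among those in the given letters is
  reduced.\<close>

lemma parabolic_reduced_word:
  assumes n: "n \<ge> 2" and J: "J \<subseteq> {0..<n}" and "set is \<subseteq> J"
    and "\<And>js. set js \<subseteq> J \<Longrightarrow> word_prod n js = word_prod n is \<Longrightarrow> length is \<le> length js"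
  shows "cox_length n (word_prod n is) = length is"
  using assms(3,4)
proof (induction "is" rule: rev_induct)
  case Nil
  show ?case using cox_length_id[of n] by (simp only: word_prod_Nil list.size)
next
  case (snoc i "is")
  let ?v = "word_prod n is" and ?s = "simple_refl n i"
  have v: "?v \<in> affine_sym n" by (rule word_prod_affine_sym[OF n])
  have i: "i \<in> J" "i < n" "set is \<subseteq> J" using snoc.prems(1) J by auto
  have "length is \<le> length js" if "set js \<subseteq> J" "word_prod n js = ?v" for js
    using snoc.prems(2)[of "js @ [i]"] that i by (simp add: word_prod_append)
  then have len: "cox_length n ?v = length is" using snoc.IH i by blast
  \<comment> \<open>At a descent, exchange would express the product with the last letter by a word
    in \<open>J\<close> two letters shorter than \<open>is @ [i]\<close>, against
    minimality.\<close>
  have "\<not> ?v (int i + 1) < ?v (int i)"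
  proof
    assume "?v (int i + 1) < ?v (int i)"
    from word_exchange[OF n _ _ this] obtain js where
      js: "Suc (length js) = length is" "set js \<subseteq> set is" "word_prod n js = ?v \<circ> ?s"
      using not_dvd_one[OF n] by (auto simp: simple_refl_def)
    have "length (is @ [i]) \<le> length js"
      using js i by (intro snoc.prems(2)) (auto simp: word_prod_append)
    then show False using js by simp
  qed
  then have "\<not> cox_length n (?v \<circ> ?s) < cox_length n ?v"
    using cox_length_transp_less_iff[OF n v, of "int i" "int i + 1"] not_dvd_one[OF n]
    by (simp add: simple_refl_def)
  then have "cox_length n (?v \<circ> ?s) = length (is @ [i])"
    using cox_length_comp_simple_refl[OF n v i(2)] len by simp
  then show ?case by (simp only: word_prod_snoc)
qed

text \<open>\<open>cox_length\<close> also counts words with the letter \<open>0\<close>. A shortest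
  word among those avoiding it is still reduced, so the final induction meets only the letters
  \<open>1, ..., n - 1\<close>.\<close>

lemma finite_sym_reduced_word:
  assumes n: "n \<ge> 2" and w: "w \<in> finite_sym n"
  obtains "is" where "set is \<subseteq> {1..<n}" "word_prod n is = w" "cox_length n w = length is"
proof -
  let ?P = "\<lambda>is. set is \<subseteq> {1..<n} \<and> word_prod n is = w"
  obtain "is" where "is": "?P is" "\<And>js. ?P js \<Longrightarrow> length is \<le> length js"
    using finite_sym_word[OF assms] ex_has_least_nat[of ?P _ length] by blast
  moreover have "cox_length n (word_prod n is) = length is"
    using "is" by (intro parabolic_reduced_word[OF n, of "{1..<n}"]) auto
  ultimately show ?thesis using that by auto
qed


section \<open>Labelings up to commutation\<close>

lemma swap_step_mset: "swap_step L L' \<Longrightarrow> mset L' = mset L"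
  by (auto simp: swap_step_def)

lemma swap_steps_mset: "swap_step\<^sup>*\<^sup>* L L' \<Longrightarrow> mset L' = mset L"
  by (induction rule: rtranclp_induct) (auto dest: swap_step_mset)

lemma swap_steps_set: "swap_step\<^sup>*\<^sup>* L L' \<Longrightarrow> set L' = set L"
  by (drule swap_steps_mset) (rule mset_eq_setD)

lemma swap_steps_labelings: "swap_step\<^sup>*\<^sup>* L L' \<Longrightarrow> L \<in> labelings T \<Longrightarrow> L' \<in> labelings T"
  using swap_steps_mset[of L L'] by (auto simp: labelings_def dest: mset_eq_setD mset_eq_imp_distinct_iff)

lemma swap_steps_sym: "swap_step\<^sup>*\<^sup>* L L' \<Longrightarrow> swap_step\<^sup>*\<^sup>* L' L"
proof -
  have "symp swap_step" by (rule sympI) (auto simp: swap_step_def, blast)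
  then show "swap_step\<^sup>*\<^sup>* L L' \<Longrightarrow> swap_step\<^sup>*\<^sup>* L' L" using symp_rtranclp sympD by metis
qed

lemma swap_step_context:
  assumes "swap_step L L'"
  shows "swap_step (us @ L @ vs) (us @ L' @ vs)"
proof -
  obtain xs b b' ys where "L = xs @ b # b' # ys" "L' = xs @ b' # b # ys"
    "{fst b, snd b} \<inter> {fst b', snd b'} = {}" using assms unfolding swap_step_def by blast
  then show ?thesis unfolding swap_step_def
    by (intro exI[of _ "us @ xs"] exI[of _ b] exI[of _ b'] exI[of _ "ys @ vs"]) simp
qed

lemma swap_steps_context: "swap_step\<^sup>*\<^sup>* L L' \<Longrightarrow> swap_step\<^sup>*\<^sup>* (us @ L @ vs) (us @ L' @ vs)"
  by (induction rule: rtranclp_induct) (auto intro: rtranclp.rtrancl_into_rtrancl swap_step_context)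

lemma swap_steps_append:
  assumes "swap_step\<^sup>*\<^sup>* xs xs'" "swap_step\<^sup>*\<^sup>* ys ys'"
  shows "swap_step\<^sup>*\<^sup>* (xs @ ys) (xs' @ ys')"
  using swap_steps_context[OF assms(1), of "[]" ys] swap_steps_context[OF assms(2), of xs' "[]"]
  by (auto intro: rtranclp_trans)

lemma swap_step_map:
  assumes "inj \<sigma>" and "swap_step L L'"
  shows "swap_step (map (map_prod \<sigma> \<sigma>) L) (map (map_prod \<sigma> \<sigma>) L')"
proof -
  let ?s = "map_prod \<sigma> \<sigma>"
  obtain xs b b' ys where L: "L = xs @ b # b' # ys" "L' = xs @ b' # b # ys"
    "{fst b, snd b} \<inter> {fst b', snd b'} = {}" using assms(2) unfolding swap_step_def by blast
  have "{fst (?s b), snd (?s b)} \<inter> {fst (?s b'), snd (?s b')} = {}"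
    using L(3) by (auto simp: fst_map_prod snd_map_prod inj_eq[OF assms(1)])
  then show ?thesis unfolding swap_step_def using L
    by (intro exI[of _ "map ?s xs"] exI[of _ "?s b"] exI[of _ "?s b'"] exI[of _ "map ?s ys"]) simp
qed

lemma swap_steps_map:
  assumes "inj \<sigma>"
  shows "swap_step\<^sup>*\<^sup>* L L' \<Longrightarrow> swap_step\<^sup>*\<^sup>* (map (map_prod \<sigma> \<sigma>) L) (map (map_prod \<sigma> \<sigma>) L')"
  by (induction rule: rtranclp_induct)
    (auto intro: rtranclp.rtrancl_into_rtrancl swap_step_map[OF assms])

text \<open>Insertion moves \<open>x\<close> only past boxes of strictly smaller key, each of which
  is disjoint from \<open>x\<close> by assumption.\<close>

lemma swap_steps_insort_key:
  assumes "\<And>b. b \<in> set xs \<Longrightarrow> key b \<noteq> key x \<Longrightarrow> {fst x, snd x} \<inter> {fst b, snd b} = {}"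
  shows "swap_step\<^sup>*\<^sup>* (x # xs) (insort_key key x xs)"
  using assms
proof (induction xs)
  case (Cons y ys)
  show ?case
  proof (cases "key x \<le> key y")
    case False
    have "swap_step ([] @ x # y # ys) ([] @ y # x # ys)"
      unfolding swap_step_def using Cons.prems[of y] False by fastforce
    moreover have "swap_step\<^sup>*\<^sup>* (y # x # ys) (y # insort_key key x ys)"
      using swap_steps_context[OF Cons.IH, of "[y]" "[]"] Cons.prems by simp
    ultimately show ?thesis using False by (auto intro: converse_rtranclp_into_rtranclp)
  qed simp
qed simp

text \<open>Insertion sort carried out by swaps. Boxes with equal keys are never exchanged, so
  disjointness is asked only for different keys.\<close>

lemma swap_steps_sort_key:
  assumes "\<And>b b'. b \<in> set xs \<Longrightarrow> b' \<in> set xs \<Longrightarrow> key b \<noteq> key b' \<Longrightarrow>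
    {fst b, snd b} \<inter> {fst b', snd b'} = {}"
  shows "swap_step\<^sup>*\<^sup>* xs (sort_key key xs)"
  using assms
proof (induction xs)
  case (Cons x xs)
  have "swap_step\<^sup>*\<^sup>* (x # xs) (x # sort_key key xs)"
    using swap_steps_context[OF Cons.IH, of "[x]" "[]"] Cons.prems by simp
  moreover have "swap_step\<^sup>*\<^sup>* (x # sort_key key xs) (insort_key key x (sort_key key xs))"
    using Cons.prems[of x] by (intro swap_steps_insort_key) auto
  ultimately show ?case by (auto intro: rtranclp_trans)
qed simp

text \<open>\<open>MN_labeling\<close> without its monotonicity conditions. What remains is stable
  under every injective relabeling of vertices.\<close>

definition split_labeling :: "box set \<Rightarrow> box list \<Rightarrow> bool" where
  "split_labeling T L \<longleftrightarrow> L \<in> labelings T \<and>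
     distinct (map fst (take (card (snd ` T) - 1) L)) \<and>
     distinct (map snd (drop (card (snd ` T) - 1) L))"

lemma MN_labeling_imp_split: "MN_labeling T L \<Longrightarrow> split_labeling T L"
  by (simp add: MN_labeling_def split_labeling_def Let_def)

text \<open>Two boxes of the first part have distinct first coordinates, so they commute unless their
  second coordinates agree; hence the first part can be sorted by second coordinates, and the second
  part similarly. The order on the integers therefore plays no role in the choice of the classes.\<close>

lemma split_imp_MN_labeling:
  assumes T: "\<forall>(i, j)\<in>T. i \<le> a \<and> a < j" and L: "split_labeling T L"
  shows "\<exists>L'. swap_step\<^sup>*\<^sup>* L L' \<and> MN_labeling T L'"
proof -
  define k where "k = card (snd ` T) - 1"
  define xs ys where "xs = take k L" and "ys = drop k L"
  define L' where "L' = sort_key snd xs @ sort_key fst ys"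
  have lab: "L \<in> labelings T" and dist: "distinct (map fst xs)" "distinct (map snd ys)"
    using L by (auto simp: split_labeling_def xs_def ys_def k_def)
  have "L = xs @ ys" by (simp add: xs_def ys_def)
  have T': "fst b \<le> a \<and> a < snd b" if "b \<in> set xs \<union> set ys" for b
  proof -
    have "set L = T" using lab by (simp add: labelings_def)
    then have "set xs \<union> set ys = T" using arg_cong[OF \<open>L = xs @ ys\<close>, of set] by simp
    then show ?thesis using that T by (auto simp: case_prod_beta)
  qed
  \<comment> \<open>First coordinates lie at or below \<open>a\<close> and second ones above it, so
    two boxes can meet only in coordinates of the same kind.\<close>
  have cross: "fst b \<noteq> snd b'" "snd b \<noteq> fst b'"
    if "b \<in> set xs \<union> set ys" "b' \<in> set xs \<union> set ys" for b b'
    using T'[OF that(1)] T'[OF that(2)] by auto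
  have "swap_step\<^sup>*\<^sup>* xs (sort_key snd xs)"
  proof (rule swap_steps_sort_key)
    fix b b' :: box assume b: "b \<in> set xs" "b' \<in> set xs" "snd b \<noteq> snd b'"
    then have "fst b \<noteq> fst b'" using dist(1) by (auto simp: distinct_map inj_on_def)
    then show "{fst b, snd b} \<inter> {fst b', snd b'} = {}" using b cross[of b b'] by auto
  qed
  moreover have "swap_step\<^sup>*\<^sup>* ys (sort_key fst ys)"
  proof (rule swap_steps_sort_key)
    fix b b' :: box assume b: "b \<in> set ys" "b' \<in> set ys" "fst b \<noteq> fst b'"
    then have "snd b \<noteq> snd b'" using dist(2) by (auto simp: distinct_map inj_on_def)
    then show "{fst b, snd b} \<inter> {fst b', snd b'} = {}" using b cross[of b b'] by auto
  qed
  ultimately have steps: "swap_step\<^sup>*\<^sup>* L L'"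
    unfolding L'_def \<open>L = xs @ ys\<close> by (rule swap_steps_append)
  have "take k L' = sort_key snd xs" "drop k L' = sort_key fst ys"
    by (cases "k \<le> length L"; simp add: L'_def xs_def ys_def)+
  moreover have "distinct (map fst (sort_key snd xs))" "distinct (map snd (sort_key fst ys))"
    using dist by (auto simp: distinct_map)
  moreover have "L' \<in> labelings T" using steps lab by (rule swap_steps_labelings)
  ultimately have "MN_labeling T L'" unfolding MN_labeling_def Let_def k_def by simp
  then show ?thesis using steps by blast
qed

text \<open>A selected class contains a split labeling by definition; conversely, sorting a split
  labeling stays in its class and produces an MN labeling.\<close>

lemma class_in_MN_classes_iff:
  assumes T: "\<forall>(i, j)\<in>T. i \<le> a \<and> a < j" and u: "u \<in> labelings T"
  shows "labeling_equiv T `` {u} \<in> MN_classes T \<longleftrightarrow> (\<exists>L. swap_step\<^sup>*\<^sup>* u L \<and> split_labeling T L)"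
    (is "?l \<longleftrightarrow> ?r")
proof
  show "?l \<Longrightarrow> ?r"
    by (auto simp: MN_classes_def labeling_equiv_def dest: MN_labeling_imp_split)
  assume ?r
  then obtain L where "swap_step\<^sup>*\<^sup>* u L" "MN_labeling T L"
    using split_imp_MN_labeling[OF T] by (meson rtranclp_trans)
  moreover from this(2) have "L \<in> labelings T" by (simp only: MN_labeling_def)
  ultimately have "L \<in> labeling_equiv T `` {u}" "MN_labeling T L"
    using u by (simp_all add: labeling_equiv_def)
  then show ?l unfolding MN_classes_def using u by (auto intro: quotientI)
qed

text \<open>Together with \<open>MN_choice_unique\<close> this replaces the quotient classes of
  \<open>MN_choice\<close> by swap sequences and split labelings.\<close>

lemma MN_choice_mem:
  assumes "MN_choice n a M" and tree: "connected_tree n a T" and "u \<in> M T"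
  shows "u \<in> labelings T" "\<exists>L. swap_step\<^sup>*\<^sup>* u L \<and> split_labeling T L"
proof -
  obtain C where C: "C \<in> MN_classes T" "u \<in> C"
    using assms unfolding MN_choice_def by blast
  then have quot: "C \<in> labelings T // labeling_equiv T" by (simp add: MN_classes_def)
  show u: "u \<in> labelings T"
    using in_quotient_imp_subset[OF equiv_labeling_equiv quot] C(2) by blast
  obtain y where y: "C = labeling_equiv T `` {y}" using quot by (rule quotientE)
  then have "(y, u) \<in> labeling_equiv T" using C(2) by simp
  then have "C = labeling_equiv T `` {u}" using equiv_class_eq[OF equiv_labeling_equiv] y by blast
  moreover have "\<forall>(i, j)\<in>T. i \<le> a \<and> a < j" using tree by (simp add: connected_tree_def)
  ultimately show "\<exists>L. swap_step\<^sup>*\<^sup>* u L \<and> split_labeling T L"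
    using class_in_MN_classes_iff[OF _ u] C(1) by blast
qed

lemma MN_choice_unique:
  assumes M: "MN_choice n a M" and tree: "connected_tree n a T" and u: "u \<in> labelings T"
    and "\<exists>L. swap_step\<^sup>*\<^sup>* u L \<and> split_labeling T L"
  shows "\<exists>!L. L \<in> M T \<and> swap_step\<^sup>*\<^sup>* u L"
proof -
  have "\<forall>(i, j)\<in>T. i \<le> a \<and> a < j" using tree by (simp add: connected_tree_def)
  then have "labeling_equiv T `` {u} \<in> MN_classes T"
    using class_in_MN_classes_iff[OF _ u] assms(4) by blast
  then have "\<exists>!L. L \<in> M T \<inter> labeling_equiv T `` {u}"
    using M tree unfolding MN_choice_def by blast
  moreover have "L \<in> labeling_equiv T `` {u} \<longleftrightarrow> swap_step\<^sup>*\<^sup>* u L" for L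
    using u by (auto simp: labeling_equiv_def intro: swap_steps_labelings)
  ultimately show ?thesis by simp
qed


section \<open>Relabeling the vertices\<close>

text \<open>The features of a simple reflection that trees see: it respects the cut at
  \<open>a\<close> and congruence modulo \<open>n\<close>. Being self-inverse, it lets each transfer
  result be used backwards as well.\<close>

definition residue_involution :: "nat \<Rightarrow> int \<Rightarrow> (int \<Rightarrow> int) \<Rightarrow> bool" where
  "residue_involution n a \<sigma> \<longleftrightarrow> (\<forall>x. \<sigma> (\<sigma> x) = x) \<and> (\<forall>x. \<sigma> x \<le> a \<longleftrightarrow> x \<le> a) \<and>
     (\<forall>x y. \<sigma> x mod int n = \<sigma> y mod int n \<longleftrightarrow> x mod int n = y mod int n)"

abbreviation relabel :: "(int \<Rightarrow> int) \<Rightarrow> box \<Rightarrow> box" where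
  "relabel \<sigma> \<equiv> map_prod \<sigma> \<sigma>"

lemma residue_involution_inj: "residue_involution n a \<sigma> \<Longrightarrow> inj \<sigma>"
  unfolding residue_involution_def by (metis injI)

lemma relabel_relabel: "residue_involution n a \<sigma> \<Longrightarrow> relabel \<sigma> (relabel \<sigma> b) = b"
  by (cases b) (simp add: residue_involution_def)

lemma image_relabel_relabel:
  "residue_involution n a \<sigma> \<Longrightarrow> relabel \<sigma> ` relabel \<sigma> ` T = T"
  by (simp only: image_image relabel_relabel image_ident)

lemma map_relabel_relabel:
  "residue_involution n a \<sigma> \<Longrightarrow> map (relabel \<sigma>) (map (relabel \<sigma>) u) = u"
  by (simp only: map_map comp_def relabel_relabel map_ident)

lemma tree_verts_relabel: "tree_verts (relabel \<sigma> ` T) = \<sigma> ` tree_verts T"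
  by (simp add: tree_verts_def image_Un image_image fst_map_prod snd_map_prod)

lemma adj_relabel: "adj T x y \<Longrightarrow> adj (relabel \<sigma> ` T) (\<sigma> x) (\<sigma> y)"
  by (force simp: adj_def)

lemma adj_rtranclp_relabel:
  "(adj T)\<^sup>*\<^sup>* x y \<Longrightarrow> (adj (relabel \<sigma> ` T))\<^sup>*\<^sup>* (\<sigma> x) (\<sigma> y)"
  by (induction rule: rtranclp_induct) (auto intro: rtranclp.rtrancl_into_rtrancl adj_relabel)

lemma has_cycle_relabel:
  assumes inj: "inj \<sigma>" and "has_cycle T"
  shows "has_cycle (relabel \<sigma> ` T)"
proof -
  obtain vs where vs: "3 \<le> length vs" "distinct vs"
    "\<forall>k < length vs. adj T (vs ! k) (vs ! (Suc k mod length vs))"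
    using assms(2) unfolding has_cycle_def by blast
  \<comment> \<open>The cyclic successor is a valid index, so \<open>map\<close> commutes with
    indexing there.\<close>
  have "Suc k mod length vs < length vs" if "k < length vs" for k
    using that by (intro mod_less_divisor) linarith
  then have "\<forall>k < length (map \<sigma> vs).
      adj (relabel \<sigma> ` T) (map \<sigma> vs ! k) (map \<sigma> vs ! (Suc k mod length (map \<sigma> vs)))"
    using vs(3) by (simp add: adj_relabel)
  moreover have "distinct (map \<sigma> vs)"
    using vs(2) by (simp add: distinct_map inj_on_subset[OF inj])
  ultimately show ?thesis
    unfolding has_cycle_def using vs(1) by (intro exI[of _ "map \<sigma> vs"]) simp
qed

lemma connected_tree_relabel:
  assumes \<sigma>: "residue_involution n a \<sigma>" and tree: "connected_tree n a T"
  shows "connected_tree n a (relabel \<sigma> ` T)"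
proof -
  have side: "\<sigma> x \<le> a \<longleftrightarrow> x \<le> a"
    and residues: "\<sigma> x mod int n = \<sigma> y mod int n \<longleftrightarrow> x mod int n = y mod int n" for x y
    using \<sigma> by (simp_all add: residue_involution_def)
  \<comment> \<open>Relabeling once more would carry a cycle of the image back to a cycle of
    \<open>T\<close>.\<close>
  have "\<not> has_cycle (relabel \<sigma> ` T)"
    using tree has_cycle_relabel[OF residue_involution_inj[OF \<sigma>], of "relabel \<sigma> ` T"]
    by (auto simp: connected_tree_def image_relabel_relabel[OF \<sigma>])
  moreover have "\<forall>x\<in>tree_verts (relabel \<sigma> ` T). \<forall>y\<in>tree_verts (relabel \<sigma> ` T).
      (adj (relabel \<sigma> ` T))\<^sup>*\<^sup>* x y"
    using tree by (auto simp: connected_tree_def tree_verts_relabel intro: adj_rtranclp_relabel)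
  moreover have "inj_on (\<lambda>x. x mod int n) (tree_verts (relabel \<sigma> ` T))"
    using tree by (auto simp: connected_tree_def tree_verts_relabel inj_on_def residues)
  moreover have "\<forall>(i, j)\<in>relabel \<sigma> ` T. i \<le> a \<and> a < j"
    using tree side by (fastforce simp: connected_tree_def not_le[symmetric])
  ultimately show ?thesis using tree by (simp add: connected_tree_def)
qed

text \<open>\<open>\<sigma>\<close> is injective and respects the cut, so the sign of a summand
  survives relabeling.\<close>

lemma c_num_relabel:
  assumes \<sigma>: "residue_involution n a \<sigma>"
  shows "c_num a (relabel \<sigma> ` T) = c_num a T"
proof -
  have "{x \<in> tree_verts (relabel \<sigma> ` T). x \<le> a} = \<sigma> ` {x \<in> tree_verts T. x \<le> a}"
    using \<sigma> by (auto simp: tree_verts_relabel residue_involution_def)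
  then show ?thesis
    unfolding c_num_def by (simp add: card_image inj_on_subset[OF residue_involution_inj[OF \<sigma>]])
qed

lemma card_relabel: "inj \<sigma> \<Longrightarrow> card (relabel \<sigma> ` T) = card T"
  by (rule card_image) (rule inj_on_subset[OF prod.inj_map subset_UNIV])

lemma labelings_relabel:
  "inj \<sigma> \<Longrightarrow> u \<in> labelings T \<Longrightarrow> map (relabel \<sigma>) u \<in> labelings (relabel \<sigma> ` T)"
  using inj_on_subset[OF prod.inj_map[of \<sigma> \<sigma>], of T] by (auto simp: labelings_def distinct_map)

text \<open>The cut position depends only on the number of distinct second coordinates, which an
  injective map preserves along with distinctness.\<close>

lemma split_labeling_relabel:
  assumes inj: "inj \<sigma>" and "split_labeling T L"
  shows "split_labeling (relabel \<sigma> ` T) (map (relabel \<sigma>) L)"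
proof -
  have "snd ` relabel \<sigma> ` T = \<sigma> ` snd ` T" by (simp add: image_image snd_map_prod)
  then have "card (snd ` relabel \<sigma> ` T) = card (snd ` T)"
    by (simp add: card_image inj_on_subset[OF inj])
  moreover have "distinct (map (\<sigma> \<circ> f) xs)" if "distinct (map f xs)" for f :: "box \<Rightarrow> int" and xs
    using that by (simp add: distinct_map comp_inj_on inj_on_subset[OF inj])
  ultimately show ?thesis
    using assms(2) labelings_relabel[OF inj]
    by (simp add: split_labeling_def take_map drop_map)
qed

text \<open>The image under \<^term>\<open>\<sigma>\<close> of a chosen representative need not be the chosen one, but it is
  equivalent to exactly one chosen representative.\<close>

lemma MN_elem_relabel:
  assumes \<sigma>: "residue_involution n a \<sigma>" and M: "MN_choice n a M"
  obtains \<phi> where "bij \<phi>" "\<And>u. MN_elem n M m a (\<phi> u) = MN_elem n M m a u"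
    "\<And>u. MN_elem n M m a u \<noteq> 0 \<Longrightarrow> swap_step\<^sup>*\<^sup>* (map (relabel \<sigma>) u) (\<phi> u)"
proof -
  note inj = residue_involution_inj[OF \<sigma>]
  \<comment> \<open>\<open>U\<close> is the set of words with nonzero coefficient. Outside it
    \<open>\<phi>\<close> is set to the identity, so that it permutes all words.\<close>
  define U where "U = {u. connected_tree n a (set u) \<and> card (set u) = m \<and> u \<in> M (set u)}"
  define P where "P u L \<longleftrightarrow> L \<in> M (relabel \<sigma> ` set u) \<and> swap_step\<^sup>*\<^sup>* (map (relabel \<sigma>) u) L" for u L
  define \<phi> where "\<phi> u = (if u \<in> U then THE L. P u L else u)" for u
  have unique: "\<exists>!L. P u L" if "u \<in> U" for u
  proof -
    have tree: "connected_tree n a (set u)" and "u \<in> M (set u)" using that by (auto simp: U_def)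
    from MN_choice_mem[OF M this] obtain L where L: "u \<in> labelings (set u)"
      "swap_step\<^sup>*\<^sup>* u L" "split_labeling (set u) L" by blast
    show ?thesis unfolding P_def
      using MN_choice_unique[OF M connected_tree_relabel[OF \<sigma> tree] labelings_relabel[OF inj L(1)]]
        swap_steps_map[OF inj L(2)] split_labeling_relabel[OF inj L(3)] by blast
  qed
  have P: "P u (\<phi> u)" if "u \<in> U" for u
    using theI'[OF unique[OF that]] that by (simp add: \<phi>_def)
  have set: "set (\<phi> u) = relabel \<sigma> ` set u" if "u \<in> U" for u
    using P[OF that] swap_steps_set[of "map (relabel \<sigma>) u" "\<phi> u"] by (simp add: P_def)
  have U: "\<phi> u \<in> U" if "u \<in> U" for u
    using that P[OF that] set[OF that]
    by (auto simp: U_def P_def card_relabel[OF inj] intro: connected_tree_relabel[OF \<sigma>])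
  \<comment> \<open>Relabeling \<open>\<phi> u\<close> leads back to the class of \<open>u\<close>,
    whose unique chosen representative is \<open>u\<close> itself.\<close>
  have "\<phi> (\<phi> u) = u" for u
  proof (cases "u \<in> U")
    case True
    have "swap_step\<^sup>*\<^sup>* (map (relabel \<sigma>) (\<phi> u)) u"
      using P[OF True] swap_steps_map[OF inj, of "map (relabel \<sigma>) u" "\<phi> u"]
      by (simp only: P_def map_relabel_relabel[OF \<sigma>]) (blast intro: swap_steps_sym)
    then have "P (\<phi> u) u"
      using True set[OF True] by (simp add: P_def U_def image_relabel_relabel[OF \<sigma>])
    then show ?thesis using P[OF U[OF True]] unique[OF U[OF True]] by blast
  qed (simp add: \<phi>_def)
  then have "bij \<phi>" by (metis involuntory_imp_bij)
  moreover have "MN_elem n M m a (\<phi> u) = MN_elem n M m a u" for u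
  proof (cases "u \<in> U")
    case True
    then show ?thesis using U[OF True] set[OF True] c_num_relabel[OF \<sigma>] by (simp add: MN_elem_def U_def)
  qed (simp add: \<phi>_def)
  moreover have "swap_step\<^sup>*\<^sup>* (map (relabel \<sigma>) u) (\<phi> u)" if "MN_elem n M m a u \<noteq> 0" for u
    using that P[of u] by (auto simp: MN_elem_def U_def P_def split: if_splits)
  ultimately show ?thesis using that by blast
qed


section \<open>Linear extensions\<close>

lemma lookup_scale: "Poly_Mapping.lookup (scale c f) x = c * Poly_Mapping.lookup f x"
  by (simp add: scale_def Poly_Mapping.map.rep_eq when_def)

lemma scale_zero_right [simp]: "scale c 0 = 0"
  by (rule poly_mapping_eqI) (simp add: lookup_scale)

lemma scale_zero_left [simp]: "scale 0 f = 0"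
  by (rule poly_mapping_eqI) (simp add: lookup_scale)

lemma scale_one [simp]: "scale 1 f = f"
  by (rule poly_mapping_eqI) (simp add: lookup_scale)

lemma scale_scale: "scale c (scale d f) = scale (c * d) f"
  by (rule poly_mapping_eqI) (simp add: lookup_scale)

lemma scale_add_left: "scale (c + d) f = scale c f + scale d f"
  by (rule poly_mapping_eqI) (simp add: lookup_scale lookup_add algebra_simps)

lemma scale_sum: "scale c (sum F S) = (\<Sum>x\<in>S. scale c (F x))"
  by (rule poly_mapping_eqI) (simp add: lookup_scale lookup_sum sum_distrib_left)

text \<open>Lets combinations with different supports be summed over a common finite index
  set.\<close>

lemma lin_ext_superset:
  assumes "finite S" "Poly_Mapping.keys f \<subseteq> S"
  shows "lin_ext F f = (\<Sum>w\<in>S. scale (Poly_Mapping.lookup f w) (F w))"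
  unfolding lin_ext_def using assms
  by (intro sum.mono_neutral_left) (auto simp: in_keys_iff)

lemma lin_ext_zero [simp]: "lin_ext F 0 = 0"
  by (simp add: lin_ext_def)

lemma lin_ext_A [simp]: "lin_ext F (A w) = F w"
  by (simp add: lin_ext_def A_def)

lemma lin_ext_add: "lin_ext F (f + g) = lin_ext F f + lin_ext F g"
proof -
  let ?S = "Poly_Mapping.keys f \<union> Poly_Mapping.keys g"
  have "lin_ext F h = (\<Sum>w\<in>?S. scale (Poly_Mapping.lookup h w) (F w))"
    if "Poly_Mapping.keys h \<subseteq> ?S" for h
    using that by (intro lin_ext_superset) auto
  then show ?thesis
    using keys_add[of f g] by (simp add: lookup_add scale_add_left sum.distrib)
qed

lemma lin_ext_scale: "lin_ext F (scale c f) = scale c (lin_ext F f)"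
proof -
  have "Poly_Mapping.keys (scale c f) \<subseteq> Poly_Mapping.keys f"
    by (auto simp: in_keys_iff lookup_scale)
  then have "lin_ext F (scale c f)
      = (\<Sum>w\<in>Poly_Mapping.keys f. scale (Poly_Mapping.lookup (scale c f) w) (F w))"
    by (intro lin_ext_superset) auto
  then show ?thesis by (simp add: lin_ext_def lookup_scale scale_sum scale_scale)
qed

lemma lin_ext_sum: "lin_ext F (sum G S) = (\<Sum>x\<in>S. lin_ext F (G x))"
  by (induction S rule: infinite_finite_induct) (auto simp: lin_ext_add)

section \<open>The nilCoxeter product\<close>

lemma nil_mult_zero_left [simp]: "nil_mult n 0 g = 0"
  by (simp add: nil_mult_def)

lemma nil_mult_scale_left: "nil_mult n (scale c f) g = scale c (nil_mult n f g)"
  by (simp add: nil_mult_def lin_ext_scale)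

lemma nil_mult_sum_left: "nil_mult n (sum F S) g = (\<Sum>x\<in>S. nil_mult n (F x) g)"
  by (simp add: nil_mult_def lin_ext_sum)

lemma nil_mult_A_A:
  "nil_mult n (A u) (A v) =
     (if cox_length n (u \<circ> v) = cox_length n u + cox_length n v then A (u \<circ> v) else 0)"
  by (simp add: nil_mult_def)

lemma nil_mult_expand:
  "nil_mult n f g =
     (\<Sum>u\<in>Poly_Mapping.keys f. scale (Poly_Mapping.lookup f u) (nil_mult n (A u) g))"
  by (simp add: nil_mult_def lin_ext_def[of _ f])

lemma nil_mult_A_id: "nil_mult n f (A id) = f"
proof (rule poly_mapping_eqI)
  fix w
  have A_id: "nil_mult n (A u) (A id) = A u" for u by (simp add: nil_mult_A_A cox_length_id)
  have "Poly_Mapping.lookup (nil_mult n f (A id)) w =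
      (\<Sum>u\<in>Poly_Mapping.keys f. Poly_Mapping.lookup f u * Poly_Mapping.lookup (A u) w)"
    by (simp add: nil_mult_expand[of n f] A_id lookup_sum lookup_scale)
  also have "\<dots> = (\<Sum>u\<in>Poly_Mapping.keys f. if u = w then Poly_Mapping.lookup f u else 0)"
    by (rule sum.cong) (auto simp: A_def lookup_single when_def)
  also have "\<dots> = Poly_Mapping.lookup f w" by (simp add: in_keys_iff)
  finally show "Poly_Mapping.lookup (nil_mult n f (A id)) w = Poly_Mapping.lookup f w" .
qed

text \<open>Both sides survive exactly when the length of the triple product is the sum of the three
  lengths: subadditivity then forces equality at the intermediate product.\<close>

lemma nil_mult_A_assoc:
  assumes n: "n \<ge> 2" and "u \<in> affine_sym n" "v \<in> affine_sym n" "s \<in> affine_sym n"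
    and len: "cox_length n (v \<circ> s) = cox_length n v + cox_length n s"
  shows "nil_mult n (nil_mult n (A u) (A v)) (A s) = nil_mult n (A u) (A (v \<circ> s))"
proof -
  have "u \<circ> v \<in> affine_sym n" using assms by (intro affine_sym_comp) auto
  then have "cox_length n (u \<circ> v) \<le> cox_length n u + cox_length n v"
    "cox_length n (u \<circ> v \<circ> s) \<le> cox_length n (u \<circ> v) + cox_length n s"
    using assms by (auto intro: cox_length_comp_le)
  then show ?thesis using len by (auto simp: nil_mult_A_A comp_assoc)
qed

text \<open>The condition on the support of \<open>f\<close> keeps all indices in the group, where
  lengths are subadditive.\<close>

lemma nil_mult_assoc:
  assumes n: "n \<ge> 2" and f: "Poly_Mapping.keys f \<subseteq> affine_sym n"
    and v: "v \<in> affine_sym n" and s: "s \<in> affine_sym n"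
    and len: "cox_length n (v \<circ> s) = cox_length n v + cox_length n s"
  shows "nil_mult n (nil_mult n f (A v)) (A s) = nil_mult n f (A (v \<circ> s))"
proof -
  have "nil_mult n (nil_mult n f (A v)) (A s) = (\<Sum>u\<in>Poly_Mapping.keys f.
      scale (Poly_Mapping.lookup f u) (nil_mult n (nil_mult n (A u) (A v)) (A s)))"
    by (subst nil_mult_expand[of n f]) (simp add: nil_mult_sum_left nil_mult_scale_left)
  also have "\<dots> = (\<Sum>u\<in>Poly_Mapping.keys f.
      scale (Poly_Mapping.lookup f u) (nil_mult n (A u) (A (v \<circ> s))))"
    using f nil_mult_A_assoc[OF n _ v s len] by (intro sum.cong) auto
  also have "\<dots> = nil_mult n f (A (v \<circ> s))" by (rule nil_mult_expand[symmetric])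
  finally show ?thesis .
qed


section \<open>The action of words\<close>

text \<open>Crossing letters and right multiplication by group basis elements preserve this set, so
  identities of operators are checked on single basis elements.\<close>

definition nil_basis :: "nat \<Rightarrow> nilcox set" where
  "nil_basis n = insert 0 (A ` affine_sym n)"

lemma nil_basisE:
  assumes "f \<in> nil_basis n"
  obtains "f = 0" | w where "w \<in> affine_sym n" "f = A w"
  using assms by (auto simp: nil_basis_def)

lemma zero_nil_basis [simp]: "0 \<in> nil_basis n"
  by (simp add: nil_basis_def)

lemma A_nil_basis: "w \<in> affine_sym n \<Longrightarrow> A w \<in> nil_basis n"
  by (simp add: nil_basis_def)

lemma keys_nil_basis: "f \<in> nil_basis n \<Longrightarrow> Poly_Mapping.keys f \<subseteq> affine_sym n"
  by (auto simp: nil_basis_def A_def)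

lemma nil_mult_nil_basis:
  assumes "n \<ge> 2" "f \<in> nil_basis n" "v \<in> affine_sym n"
  shows "nil_mult n f (A v) \<in> nil_basis n"
  using assms(2)
proof (cases rule: nil_basisE)
  case (2 w)
  then show ?thesis using assms by (auto simp: nil_mult_A_A intro!: A_nil_basis affine_sym_comp)
qed simp

lemma act_letter_zero [simp]: "act_letter n 0 b = 0"
  by (simp add: act_letter_def)

lemma act_letter_A:
  "act_letter n (A w) (i, j) =
     (if cox_length n (w \<circ> affine_transp n i j) + 1 = cox_length n w
      then A (w \<circ> affine_transp n i j) else 0)"
  by (simp add: act_letter_def Let_def)

text \<open>The letters available for the cut at \<open>a = 0\<close>, with endpoints incongruent so
  that \<open>affine_transp\<close> is a genuine reflection.\<close>

definition crossing :: "nat \<Rightarrow> box \<Rightarrow> bool" where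
  "crossing n b \<longleftrightarrow> fst b \<le> 0 \<and> 0 < snd b \<and> \<not> int n dvd snd b - fst b"

lemma act_letter_nil_basis:
  assumes "n \<ge> 2" "f \<in> nil_basis n" "crossing n b"
  shows "act_letter n f b \<in> nil_basis n"
  using assms(2)
proof (cases rule: nil_basisE)
  case (2 w)
  obtain i j where b: "b = (i, j)" by (cases b)
  show ?thesis using 2 assms unfolding b
    by (auto simp: act_letter_A crossing_def intro!: A_nil_basis affine_sym_comp affine_transp_affine_sym)
qed simp

lemma act_word_Nil [simp]: "act_word n f [] = f"
  by (simp add: act_word_def)

lemma act_word_Cons [simp]: "act_word n f (b # u) = act_word n (act_letter n f b) u"
  by (simp add: act_word_def)

lemma act_word_append: "act_word n f (u @ v) = act_word n (act_word n f u) v"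
  by (simp add: act_word_def)

lemma act_word_nil_basis:
  assumes "n \<ge> 2" "f \<in> nil_basis n" "\<forall>b\<in>set u. crossing n b"
  shows "act_word n f u \<in> nil_basis n"
  using assms(2,3) by (induction u arbitrary: f) (auto intro: act_letter_nil_basis[OF assms(1)])

text \<open>Conjugation by the first reflection fixes both \<open>k\<close> and
  \<open>l\<close>.\<close>

lemma affine_transp_commute:
  assumes n: "n > 0" and "\<not> int n dvd j - i"
    and "\<not> int n dvd k - i" "\<not> int n dvd k - j" "\<not> int n dvd l - i" "\<not> int n dvd l - j"
  shows "affine_transp n i j \<circ> affine_transp n k l = affine_transp n k l \<circ> affine_transp n i j"
  using affine_transp_conj[OF affine_transp_affine_sym[OF assms(1,2)], of k l] assms(3-)
  by (simp add: affine_transp_other)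

text \<open>Neither reflection changes the values compared by the other, so each lowers the length
  in either order. The total drop is two, hence both strict drops equal one.\<close>

lemma commuting_covers:
  assumes n: "n \<ge> 2" and w: "w \<in> affine_sym n"
    and ij: "i < j" "\<not> int n dvd j - i" and kl: "k < l" "\<not> int n dvd l - k"
    and disj: "\<not> int n dvd k - i" "\<not> int n dvd k - j" "\<not> int n dvd l - i" "\<not> int n dvd l - j"
    and cov: "cox_length n (w \<circ> affine_transp n i j) + 1 = cox_length n w"
      "cox_length n (w \<circ> affine_transp n i j \<circ> affine_transp n k l) + 1
        = cox_length n (w \<circ> affine_transp n i j)"
  shows "cox_length n (w \<circ> affine_transp n k l) + 1 = cox_length n w"
    and "cox_length n (w \<circ> affine_transp n k l \<circ> affine_transp n i j) + 1
        = cox_length n (w \<circ> affine_transp n k l)"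
proof -
  let ?t = "affine_transp n i j" and ?t' = "affine_transp n k l"
  have sym: "\<not> int n dvd i - k" "\<not> int n dvd i - l" "\<not> int n dvd j - k" "\<not> int n dvd j - l"
    using disj by (simp_all add: dvd_diff_commute)
  have wt: "w \<circ> ?t \<in> affine_sym n" and wt': "w \<circ> ?t' \<in> affine_sym n"
    using n w ij kl by (auto intro!: affine_sym_comp affine_transp_affine_sym)
  have comm: "w \<circ> ?t \<circ> ?t' = w \<circ> ?t' \<circ> ?t"
    using affine_transp_commute[OF _ ij(2) disj] n by (simp add: comp_assoc)
  have "w j < w i" using cox_length_transp_less_iff[OF n w ij] cov(1) by simp
  have "(w \<circ> ?t) l < (w \<circ> ?t) k" using cox_length_transp_less_iff[OF n wt kl] cov(2) by simp
  then have "w l < w k" using disj by (simp add: affine_transp_other)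
  then have less1: "cox_length n (w \<circ> ?t') < cox_length n w"
    using cox_length_transp_less_iff[OF n w kl] by simp
  have "(w \<circ> ?t') j < (w \<circ> ?t') i" using \<open>w j < w i\<close> sym by (simp add: affine_transp_other)
  then have less2: "cox_length n (w \<circ> ?t' \<circ> ?t) < cox_length n (w \<circ> ?t')"
    using cox_length_transp_less_iff[OF n wt' ij] by simp
  have len: "cox_length n (w \<circ> ?t' \<circ> ?t) + 2 = cox_length n w"
    using cov unfolding comm by linarith
  show "cox_length n (w \<circ> ?t') + 1 = cox_length n w"
    using less1 less2 len by linarith
  show "cox_length n (w \<circ> ?t' \<circ> ?t) + 1 = cox_length n (w \<circ> ?t')"
    using less1 less2 len by linarith
qed

text \<open>Disjointness is asked modulo \<open>n\<close>, because reflections with merely congruent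
  endpoints need not commute.\<close>

lemma act_letter_commute:
  assumes n: "n \<ge> 2" and f: "f \<in> nil_basis n" and b: "crossing n b" "crossing n b'"
    and disj: "\<And>x y. x \<in> {fst b, snd b} \<Longrightarrow> y \<in> {fst b', snd b'} \<Longrightarrow> \<not> int n dvd y - x"
  shows "act_letter n (act_letter n f b) b' = act_letter n (act_letter n f b') b"
  using f
proof (cases rule: nil_basisE)
  case (2 w)
  obtain i j k l where bs: "b = (i, j)" "b' = (k, l)" by (cases b, cases b') auto
  let ?t = "affine_transp n i j" and ?t' = "affine_transp n k l"
  have ij: "i < j" "\<not> int n dvd j - i" and kl: "k < l" "\<not> int n dvd l - k"
    using b by (auto simp: crossing_def bs)
  have d: "\<not> int n dvd k - i" "\<not> int n dvd k - j" "\<not> int n dvd l - i" "\<not> int n dvd l - j"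
    using disj by (auto simp: bs)
  then have d': "\<not> int n dvd i - k" "\<not> int n dvd i - l" "\<not> int n dvd j - k" "\<not> int n dvd j - l"
    by (simp_all add: dvd_diff_commute)
  have comm: "w \<circ> ?t \<circ> ?t' = w \<circ> ?t' \<circ> ?t"
    using affine_transp_commute[OF _ ij(2) d] n by (simp add: comp_assoc)
  have lhs: "act_letter n (act_letter n f b) b' =
      (if cox_length n (w \<circ> ?t) + 1 = cox_length n w \<and>
          cox_length n (w \<circ> ?t \<circ> ?t') + 1 = cox_length n (w \<circ> ?t) then A (w \<circ> ?t \<circ> ?t') else 0)"
    using 2 by (auto simp: bs act_letter_A)
  have rhs: "act_letter n (act_letter n f b') b =
      (if cox_length n (w \<circ> ?t') + 1 = cox_length n w \<and>
          cox_length n (w \<circ> ?t' \<circ> ?t) + 1 = cox_length n (w \<circ> ?t') then A (w \<circ> ?t' \<circ> ?t) else 0)"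
    using 2 by (auto simp: bs act_letter_A)
  show ?thesis
    unfolding lhs rhs comm[symmetric]
    using commuting_covers[OF n 2(1) ij kl d] commuting_covers[OF n 2(1) kl ij d'] comm by metis
qed simp

text \<open>The endpoints of a box are two different vertices of the tree, so their residues
  differ.\<close>

lemma connected_tree_crossing:
  assumes "connected_tree n 0 T" "b \<in> T"
  shows "crossing n b"
proof -
  have v: "fst b \<in> tree_verts T" "snd b \<in> tree_verts T"
    using assms(2) by (simp_all add: tree_verts_def)
  have "\<forall>(i, j)\<in>T. i \<le> 0 \<and> 0 < j" using assms(1) by (simp add: connected_tree_def)
  then have b: "fst b \<le> 0" "0 < snd b" using assms(2) by (auto simp: case_prod_beta)
  have "inj_on (\<lambda>x. x mod int n) (tree_verts T)" using assms by (simp add: connected_tree_def)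
  then have "snd b mod int n \<noteq> fst b mod int n" using v b by (auto dest: inj_onD)
  then show ?thesis using b by (simp add: crossing_def mod_eq_dvd_iff)
qed

text \<open>A swap only asks for supports disjoint as sets of integers; the distinct residues of the
  tree vertices make them disjoint modulo \<open>n\<close>.\<close>

lemma act_word_swap_step:
  assumes n: "n \<ge> 2" and f: "f \<in> nil_basis n" and tree: "connected_tree n 0 (set u)"
    and "swap_step u u'"
  shows "act_word n f u = act_word n f u'"
proof -
  obtain xs b b' ys where u: "u = xs @ b # b' # ys" "u' = xs @ b' # b # ys"
    "{fst b, snd b} \<inter> {fst b', snd b'} = {}" using assms(4) unfolding swap_step_def by blast
  have cross: "\<forall>c\<in>set u. crossing n c" using connected_tree_crossing[OF tree] by blast
  have inj: "inj_on (\<lambda>x. x mod int n) (tree_verts (set u))"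
    using tree by (simp add: connected_tree_def)
  have "act_letter n (act_letter n (act_word n f xs) b) b' =
    act_letter n (act_letter n (act_word n f xs) b') b"
  proof (rule act_letter_commute[OF n])
    show "act_word n f xs \<in> nil_basis n"
      using cross u(1) by (intro act_word_nil_basis[OF n f]) auto
    show "crossing n b" "crossing n b'" using cross u(1) by auto
    fix x y assume xy: "x \<in> {fst b, snd b}" "y \<in> {fst b', snd b'}"
    then have "x \<in> tree_verts (set u)" "y \<in> tree_verts (set u)"
      by (auto simp: tree_verts_def u(1))
    moreover have "y \<noteq> x" using xy u(3) by blast
    ultimately have "y mod int n \<noteq> x mod int n" using inj by (auto dest: inj_onD)
    then show "\<not> int n dvd y - x" by (simp add: mod_eq_dvd_iff)
  qed
  then show ?thesis by (simp add: u act_word_append)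
qed

lemma act_word_swap_steps:
  assumes n: "n \<ge> 2" and f: "f \<in> nil_basis n" and tree: "connected_tree n 0 (set u)"
    and "swap_step\<^sup>*\<^sup>* u u'"
  shows "act_word n f u = act_word n f u'"
  using assms(4)
proof (induction rule: rtranclp_induct)
  case (step v v')
  have "set v = set u" using step.hyps(1) by (rule swap_steps_set)
  then show ?case using act_word_swap_step[OF n f _ step.hyps(2)] tree step.IH by simp
qed simp


section \<open>Finiteness of the sums\<close>

text \<open>The displacement is periodic, hence bounded by the sum of its absolute values over a
  period.\<close>

lemma affine_sym_bounded_displacement:
  assumes n: "n > 0" and w: "w \<in> affine_sym n"
  shows "\<exists>c. \<forall>x. \<bar>w x - x\<bar> \<le> c"
proof (intro exI allI)
  fix x
  let ?r = "x mod int n"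
  have x: "?r + (x div int n) * int n = x" by simp
  have "w x - x = w ?r - ?r"
    using affine_sym_periodic[OF w, of ?r "x div int n"] unfolding x using x by linarith
  moreover have "\<bar>w ?r - ?r\<bar> \<le> (\<Sum>y\<in>{0..<int n}. \<bar>w y - y\<bar>)"
    using n by (intro member_le_sum[of ?r _ "\<lambda>y. \<bar>w y - y\<bar>"]) auto
  ultimately show "\<bar>w x - x\<bar> \<le> (\<Sum>y\<in>{0..<int n}. \<bar>w y - y\<bar>)" by simp
qed

lemma finite_nonzero_letters:
  assumes n: "n \<ge> 2" and f: "f \<in> nil_basis n"
  shows "finite {b. crossing n b \<and> act_letter n f b \<noteq> 0}"
  using f
proof (cases rule: nil_basisE)
  case (2 w)
  obtain c where c: "\<And>x. \<bar>w x - x\<bar> \<le> c"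
    using affine_sym_bounded_displacement[of n w] n 2 by auto
  have "{b. crossing n b \<and> act_letter n f b \<noteq> 0} \<subseteq> {- 2 * c..0} \<times> {0..2 * c}"
  proof
    fix b assume "b \<in> {b. crossing n b \<and> act_letter n f b \<noteq> 0}"
    then obtain i j where b: "b = (i, j)" "crossing n (i, j)" "act_letter n f (i, j) \<noteq> 0"
      by (cases b) auto
    then have ij: "i \<le> 0" "0 < j" "\<not> int n dvd j - i" by (auto simp: crossing_def)
    have "w j < w i"
      using cox_length_transp_less_iff[OF n 2(1) _ ij(3)] b(3) ij 2(2)
      by (auto simp: act_letter_A split: if_splits)
    then show "b \<in> {- 2 * c..0} \<times> {0..2 * c}" using b(1) ij c[of i] c[of j] by auto
  qed
  then show ?thesis by (rule finite_subset) simp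
qed simp

lemma finite_nonzero_words:
  assumes n: "n \<ge> 2" and "f \<in> nil_basis n"
  shows "finite {u. length u = m \<and> (\<forall>b\<in>set u. crossing n b) \<and> act_word n f u \<noteq> 0}"
  using assms(2)
proof (induction m arbitrary: f)
  case 0
  show ?case by (rule finite_subset[of _ "{[]}"]) auto
next
  case (Suc m)
  let ?B = "{b. crossing n b \<and> act_letter n f b \<noteq> 0}"
  let ?S = "\<lambda>f. {u. length u = m \<and> (\<forall>b\<in>set u. crossing n b) \<and> act_word n f u \<noteq> 0}"
  have zero: "act_word n 0 u = 0" for u by (induction u) auto
  have sub: "{u. length u = Suc m \<and> (\<forall>b\<in>set u. crossing n b) \<and> act_word n f u \<noteq> 0}
      \<subseteq> (\<Union>b\<in>?B. (#) b ` ?S (act_letter n f b))"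
  proof
    fix u assume u: "u \<in> {u. length u = Suc m \<and> (\<forall>b\<in>set u. crossing n b) \<and> act_word n f u \<noteq> 0}"
    then obtain b v where "u = b # v" by (cases u) auto
    with u zero[of v] have "b \<in> ?B" "v \<in> ?S (act_letter n f b)" by auto
    then show "u \<in> (\<Union>b\<in>?B. (#) b ` ?S (act_letter n f b))" using \<open>u = b # v\<close> by blast
  qed
  have "finite (?S (act_letter n f b))" if "b \<in> ?B" for b
    using that by (intro Suc.IH act_letter_nil_basis[OF n Suc.prems]) simp
  then have "finite (\<Union>b\<in>?B. (#) b ` ?S (act_letter n f b))"
    by (intro finite_UN_I[OF finite_nonzero_letters[OF n Suc.prems]] finite_imageI)
  then show ?case by (rule finite_subset[OF sub])
qed

lemma MN_elem_neq_zeroD: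
  assumes "MN_choice n 0 M" and "MN_elem n M m 0 u \<noteq> 0"
  shows "connected_tree n 0 (set u)" "length u = m" "\<forall>b\<in>set u. crossing n b"
proof -
  show tree: "connected_tree n 0 (set u)" using assms(2) by (auto simp: MN_elem_def split: if_splits)
  have "u \<in> M (set u)" "card (set u) = m" using assms(2) by (auto simp: MN_elem_def split: if_splits)
  moreover from MN_choice_mem(1)[OF assms(1) tree this(1)] have "distinct u"
    by (simp add: labelings_def)
  ultimately show "length u = m" using distinct_card[of u] by simp
  show "\<forall>b\<in>set u. crossing n b" using connected_tree_crossing[OF tree] by blast
qed

lemma finite_MN_support:
  assumes n: "n \<ge> 2" and f: "f \<in> nil_basis n" and M: "MN_choice n 0 M"
  shows "finite {u. scale (MN_elem n M m 0 u) (act_word n f u) \<noteq> 0}"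
proof (rule finite_subset[OF _ finite_nonzero_words[OF n f, of m]], intro subsetI CollectI)
  fix u assume "u \<in> {u. scale (MN_elem n M m 0 u) (act_word n f u) \<noteq> 0}"
  then have "MN_elem n M m 0 u \<noteq> 0" "act_word n f u \<noteq> 0" by auto
  then show "length u = m \<and> (\<forall>b\<in>set u. crossing n b) \<and> act_word n f u \<noteq> 0"
    using MN_elem_neq_zeroD[OF M] by blast
qed

lemma keys_D_MN_elem:
  assumes n: "n \<ge> 2" and f: "f \<in> nil_basis n" and M: "MN_choice n 0 M"
  shows "Poly_Mapping.keys (D n (MN_elem n M m 0) f) \<subseteq> affine_sym n"
proof
  fix w assume "w \<in> Poly_Mapping.keys (D n (MN_elem n M m 0) f)"
  then have "(\<Sum>u | scale (MN_elem n M m 0 u) (act_word n f u) \<noteq> 0.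
      Poly_Mapping.lookup (scale (MN_elem n M m 0 u) (act_word n f u)) w) \<noteq> 0"
    by (simp add: in_keys_iff D_def Sum_any.expand_set lookup_sum)
  then obtain u where "Poly_Mapping.lookup (scale (MN_elem n M m 0 u) (act_word n f u)) w \<noteq> 0"
    by (rule sum.not_neutral_contains_not_neutral)
  then have "MN_elem n M m 0 u \<noteq> 0" "w \<in> Poly_Mapping.keys (act_word n f u)"
    by (auto simp: lookup_scale in_keys_iff)
  moreover from MN_elem_neq_zeroD(3)[OF M this(1)] have "act_word n f u \<in> nil_basis n"
    by (intro act_word_nil_basis[OF n f])
  ultimately show "w \<in> affine_sym n" using keys_nil_basis by blast
qed


section \<open>Commutation with a simple reflection\<close>

lemma simple_refl_le_zero_iff:
  assumes k: "k \<in> {1..<n}"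
  shows "simple_refl n k x \<le> 0 \<longleftrightarrow> x \<le> 0"
proof -
  have "x \<noteq> 0" if "int n dvd x - int k"
    using that k zdvd_imp_le[of "int n" "int k"] by auto
  moreover have "x \<noteq> 1" if "int n dvd x - (int k + 1)"
    using that k zdvd_imp_le[of "int n" "int k"] by auto
  ultimately show ?thesis by (auto simp: simple_refl_def affine_transp_def)
qed

lemma residue_involution_simple_refl:
  assumes n: "n \<ge> 2" and k: "k \<in> {1..<n}"
  shows "residue_involution n 0 (simple_refl n k)"
  unfolding residue_involution_def
proof (intro conjI allI)
  fix x y
  show "simple_refl n k (simple_refl n k x) = x"
    using fun_cong[OF simple_refl_involution[OF n, of k], of x] by simp
  show "simple_refl n k x \<le> 0 \<longleftrightarrow> x \<le> 0" by (rule simple_refl_le_zero_iff[OF k])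
  show "simple_refl n k x mod int n = simple_refl n k y mod int n \<longleftrightarrow> x mod int n = y mod int n"
    by (rule affine_sym_mod_eq_iff[OF simple_refl_affine_sym[OF n]])
qed

text \<open>Since \<open>s\<close> does not exchange \<open>0\<close> and \<open>1\<close>, it preserves the order of \<open>i \<le> 0 < j\<close>, and
  the reflections in \<open>(i, j)\<close> and \<open>(s i, s j)\<close> are conjugate under \<open>s\<close>.\<close>

lemma act_letter_nil_mult_simple:
  assumes n: "n \<ge> 2" and k: "k \<in> {1..<n}" and f: "f \<in> nil_basis n" and b: "crossing n b"
  defines "s \<equiv> simple_refl n k"
  shows "act_letter n (nil_mult n f (A s)) b = nil_mult n (act_letter n f (map_prod s s b)) (A s)"
  using f
proof (cases rule: nil_basisE)
  case (2 w)
  note w = 2(1)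
  obtain i j where ij: "b = (i, j)" by (cases b)
  let ?t = "affine_transp n i j" and ?t' = "affine_transp n (s i) (s j)"
  have s: "s \<in> affine_sym n" unfolding s_def by (rule simple_refl_affine_sym[OF n])
  have ls: "cox_length n s = 1" using cox_length_simple_refl[OF n] k by (simp add: s_def)
  have lt: "i < j" "\<not> int n dvd j - i" using b by (auto simp: ij crossing_def)
  have lt': "s i < s j" "\<not> int n dvd s j - s i"
    using b simple_refl_le_zero_iff[OF k, of i] simple_refl_le_zero_iff[OF k, of j]
      affine_sym_dvd_iff[OF s, of j i] by (auto simp: ij crossing_def s_def)
  have ws: "w \<circ> s \<in> affine_sym n" and wt': "w \<circ> ?t' \<in> affine_sym n"
    using n w s lt' by (auto intro!: affine_sym_comp affine_transp_affine_sym)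
  have conj: "w \<circ> s \<circ> ?t = w \<circ> ?t' \<circ> s"
    using affine_transp_conj[OF s, of i j] by (simp add: comp_assoc)
  have step: "cox_length n (u \<circ> s) = Suc (cox_length n u) \<or> Suc (cox_length n (u \<circ> s)) = cox_length n u"
    if "u \<in> affine_sym n" for u
    unfolding s_def using k by (intro cox_length_comp_simple_refl[OF n that]) auto
  have less_iff: "cox_length n (w \<circ> ?t' \<circ> s) < cox_length n (w \<circ> s) \<longleftrightarrow>
      cox_length n (w \<circ> ?t') < cox_length n w"
    using cox_length_transp_less_iff[OF n ws lt] cox_length_transp_less_iff[OF n w lt']
    unfolding conj by simp
  have "cox_length n (w \<circ> s) = cox_length n w + 1 \<and>
        cox_length n (w \<circ> ?t' \<circ> s) + 1 = cox_length n (w \<circ> s) \<longleftrightarrow>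
      cox_length n (w \<circ> ?t') + 1 = cox_length n w \<and>
        cox_length n (w \<circ> ?t' \<circ> s) = cox_length n (w \<circ> ?t') + 1"
    using step[OF w] step[OF wt'] less_iff by linarith
  then show ?thesis
    unfolding 2(2) ij by (auto simp: nil_mult_A_A act_letter_A ls conj)
qed simp

lemma crossing_map_simple_refl:
  assumes n: "n \<ge> 2" and k: "k \<in> {1..<n}" and b: "crossing n b"
  shows "crossing n (map_prod (simple_refl n k) (simple_refl n k) b)"
  using b simple_refl_le_zero_iff[OF k, of "fst b"] simple_refl_le_zero_iff[OF k, of "snd b"]
    affine_sym_dvd_iff[OF simple_refl_affine_sym[OF n], of k "snd b" "fst b"]
  by (simp add: crossing_def fst_map_prod snd_map_prod not_le[symmetric])

lemma act_word_nil_mult_simple: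
  assumes n: "n \<ge> 2" and k: "k \<in> {1..<n}" and "f \<in> nil_basis n" "\<forall>b\<in>set u. crossing n b"
  defines "s \<equiv> simple_refl n k"
  shows "act_word n (nil_mult n f (A s)) u =
    nil_mult n (act_word n f (map (map_prod s s) u)) (A s)"
  using assms(3,4)
proof (induction u arbitrary: f)
  case (Cons b u)
  have "act_letter n f (map_prod s s b) \<in> nil_basis n"
    using Cons.prems crossing_map_simple_refl[OF n k] unfolding s_def
    by (intro act_letter_nil_basis[OF n]) auto
  then show ?case
    using Cons.IH[of "act_letter n f (map_prod s s b)"] Cons.prems
      act_letter_nil_mult_simple[OF n k Cons.prems(1), of b]
    by (simp add: s_def)
qed simp

lemma D_MN_elem_nil_mult_simple:
  assumes n: "n \<ge> 2" and k: "k \<in> {1..<n}" and f: "f \<in> nil_basis n" and M: "MN_choice n 0 M"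
  shows "D n (MN_elem n M m 0) (nil_mult n f (A (simple_refl n k))) =
    nil_mult n (D n (MN_elem n M m 0) f) (A (simple_refl n k))"
proof -
  define s where "s = simple_refl n k"
  have s: "residue_involution n 0 s"
    unfolding s_def by (rule residue_involution_simple_refl[OF n k])
  define x where "x = MN_elem n M m 0"
  define h where "h u = scale (x u) (act_word n f u)" for u
  obtain \<phi> where \<phi>: "bij \<phi>" "\<And>u. x (\<phi> u) = x u"
    "\<And>u. x u \<noteq> 0 \<Longrightarrow> swap_step\<^sup>*\<^sup>* (map (relabel s) u) (\<phi> u)"
    using MN_elem_relabel[OF s M] unfolding x_def by metis
  have "scale (x u) (act_word n (nil_mult n f (A s)) u) = nil_mult n (h (\<phi> u)) (A s)" for u
  proof (cases "x u = 0")
    case False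
    note u = MN_elem_neq_zeroD[OF M False[unfolded x_def]]
    have "connected_tree n 0 (set (map (relabel s) u))"
      using connected_tree_relabel[OF s u(1)] by simp
    from act_word_swap_steps[OF n f this \<phi>(3)[OF False]] show ?thesis
      using act_word_nil_mult_simple[OF n k f u(3)] \<phi>(2)
      by (simp add: h_def nil_mult_scale_left s_def)
  qed (simp add: h_def \<phi>(2))
  then have "D n x (nil_mult n f (A s)) = Sum_any (\<lambda>u. nil_mult n (h (\<phi> u)) (A s))"
    by (simp add: D_def)
  also have "\<dots> = Sum_any (\<lambda>u. nil_mult n (h u) (A s))"
    by (rule Sum_any.reindex_cong[OF \<phi>(1), symmetric]) auto
  also have "\<dots> = (\<Sum>u | h u \<noteq> 0. nil_mult n (h u) (A s))"
    using finite_MN_support[OF n f M] unfolding h_def x_def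
    by (intro Sum_any.expand_superset) auto
  also have "\<dots> = nil_mult n (D n x f) (A s)"
    by (simp add: D_def Sum_any.expand_set nil_mult_sum_left h_def)
  finally show ?thesis unfolding x_def s_def .
qed

theorem theorem5p3:
  fixes n m :: nat and w w' :: "int \<Rightarrow> int" and M :: "box set \<Rightarrow> box list set"
  assumes "n \<ge> 2" and "m \<ge> 1"
    and "w \<in> affine_sym n" and "w' \<in> finite_sym n"
    and "MN_choice n 0 M"
  shows "D n (MN_elem n M m 0) (nil_mult n (A w) (A w')) =
         nil_mult n (D n (MN_elem n M m 0) (A w)) (A w')"
proof -
  note n = assms(1) and M = assms(5)
  let ?D = "D n (MN_elem n M m 0)"
  have Aw: "A w \<in> nil_basis n" by (rule A_nil_basis[OF assms(3)])
  have keys: "Poly_Mapping.keys (A w) \<subseteq> affine_sym n"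
    "Poly_Mapping.keys (?D (A w)) \<subseteq> affine_sym n"
    by (rule keys_nil_basis[OF Aw], rule keys_D_MN_elem[OF n Aw M])
  obtain "is" where "set is \<subseteq> {1..<n}" "word_prod n is = w'"
      "cox_length n (word_prod n is) = length is"
    using finite_sym_reduced_word[OF n assms(4)] by metis
  moreover have "?D (nil_mult n (A w) (A (word_prod n is))) =
      nil_mult n (?D (A w)) (A (word_prod n is))"
    if "set is \<subseteq> {1..<n}" "cox_length n (word_prod n is) = length is" for "is"
    using that
  proof (induction "is" rule: rev_induct)
    case Nil
    show ?case by (simp only: word_prod_Nil nil_mult_A_id)
  next
    case (snoc k "is")
    let ?v = "word_prod n is" and ?s = "simple_refl n k"
    have k: "k \<in> {1..<n}" and "set is \<subseteq> {1..<n}" using snoc.prems(1) by auto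
    have v: "?v \<in> affine_sym n" and s: "?s \<in> affine_sym n"
      by (rule word_prod_affine_sym[OF n], rule simple_refl_affine_sym[OF n])
    have ls: "cox_length n ?s = 1" using cox_length_simple_refl[OF n] k by simp
    have len: "cox_length n (?v \<circ> ?s) = Suc (length is)"
      using snoc.prems(2) by (simp only: word_prod_snoc length_append list.size)
    have "cox_length n ?v \<le> length is"
      using \<open>set is \<subseteq> {1..<n}\<close> by (intro cox_length_le) auto
    moreover have "cox_length n (?v \<circ> ?s) \<le> cox_length n ?v + 1"
      using cox_length_comp_le[OF n v s] ls by simp
    ultimately have lv: "cox_length n ?v = length is" using len by linarith
    then have add: "cox_length n (?v \<circ> ?s) = cox_length n ?v + cox_length n ?s"
      using len ls by simp
    have "?D (nil_mult n (A w) (A (?v \<circ> ?s))) = ?D (nil_mult n (nil_mult n (A w) (A ?v)) (A ?s))"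
      by (simp only: nil_mult_assoc[OF n keys(1) v s add])
    also have "\<dots> = nil_mult n (?D (nil_mult n (A w) (A ?v))) (A ?s)"
      by (rule D_MN_elem_nil_mult_simple[OF n k nil_mult_nil_basis[OF n Aw v] M])
    also have "\<dots> = nil_mult n (nil_mult n (?D (A w)) (A ?v)) (A ?s)"
      by (simp only: snoc.IH[OF \<open>set is \<subseteq> {1..<n}\<close> lv])
    also have "\<dots> = nil_mult n (?D (A w)) (A (?v \<circ> ?s))"
      by (rule nil_mult_assoc[OF n keys(2) v s add])
    finally show ?case by (simp only: word_prod_snoc)
  qed
  ultimately show ?thesis by blast
qed

end
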